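(* For $n\ge0$ let $S_n(t)=\frac{(t-1)R_n(t)}{2n+\alpha+\beta+\gamma+1}+1$. Then for $t\in(0,1)$, $S_n$ satisfies the Painlevé VI equation \begin{align*} S_n''&=\frac12\left(\frac1{S_n}+\frac1{S_n-1}+\frac1{S_n-t}\right)(S_n')^2-\left(\frac1t+\frac1{t-1}+\frac1{S_n-t}\right)S_n'\\ &\quad+\frac{S_n(S_n-1)(S_n-t)}{t^2(t-1)^2}\left(\mu_1+\frac{\mu_2t}{S_n^2}+\frac{\mu_3(t-1)}{(S_n-1)^2}+\frac{\mu_4t(t-1)}{(S_n-t)^2}\right), \end{align*} with $\mu_1=\frac{(2n+\alpha+\beta+\gamma+1)^2}{2}$, $\mu_2=-\frac{\alpha^2}{2}$, $\mu_3=\frac{\beta^2}{2}$, $\mu_4=\frac{1-\gamma^2}{2}$.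
   Context: Fix $\alpha,\beta,\gamma>0$ and real constants $A,B$ with $A\ge0$, $A+B\ge0$, not both $A$ and $A+B$ equal to $0$. Let $\theta$ be the Heaviside function. For $t\in(0,1)$ put $w(x,t)=x^{\alpha}(1-x)^{\beta}|x-t|^{\gamma}(A+B\theta(x-t))$ on $[0,1]$. Let $P_n(x,t)$ be the monic polynomials of degree $n$ orthogonal w.r.t. $w(\cdot,t)$ on $[0,1]$, $\int_0^1P_mP_nw\,dx=h_n(t)\delta_{mn}$, and $R_n(t)=\frac{\beta}{h_n(t)}\int_0^1\frac{P_n^2(y,t)w(y,t)}{1-y}dy$.
   Formalization: The equation is asserted only at those t in (0,1) where S_n(t) is not 0, 1 or t, since its right-hand side is undefined otherwise (e.g. S_0(1/2)=1/2 when α=β, B=0); S_n is shown twice differentiable on all of (0,1). *)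

theory Defs
  imports "HOL-Analysis.Analysis" "HOL-Computational_Algebra.Polynomial"
begin

text \<open>Heaviside function theta(s) = 1 for s >= 0, 0 otherwise (the value at 0 is irrelevant:
  the weight vanishes there because of the factor abs(x-t) powr gamma).\<close>
definition heaviside :: "real \<Rightarrow> real" where
  "heaviside s = (if s \<ge> 0 then 1 else 0)"

definition pvi_weight :: "real \<Rightarrow> real \<Rightarrow> real \<Rightarrow> real \<Rightarrow> real \<Rightarrow> real \<Rightarrow> real \<Rightarrow> real" where
  "pvi_weight \<alpha> \<beta> \<gamma> A B x t =
     x powr \<alpha> * (1 - x) powr \<beta> * \<bar>x - t\<bar> powr \<gamma> * (A + B * heaviside (x - t))"

definition monic_OP :: "real \<Rightarrow> real \<Rightarrow> real \<Rightarrow> real \<Rightarrow> real \<Rightarrow> nat \<Rightarrow> real \<Rightarrow> real poly" where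
  "monic_OP \<alpha> \<beta> \<gamma> A B n t =
     (THE p. degree p = n \<and> lead_coeff p = 1 \<and>
        (\<forall>q :: real poly. degree q < n \<longrightarrow>
           integral {0..1} (\<lambda>x. poly p x * poly q x * pvi_weight \<alpha> \<beta> \<gamma> A B x t) = 0))"

definition hn :: "real \<Rightarrow> real \<Rightarrow> real \<Rightarrow> real \<Rightarrow> real \<Rightarrow> nat \<Rightarrow> real \<Rightarrow> real" where
  "hn \<alpha> \<beta> \<gamma> A B n t =
     integral {0..1} (\<lambda>x. (poly (monic_OP \<alpha> \<beta> \<gamma> A B n t) x)\<^sup>2 * pvi_weight \<alpha> \<beta> \<gamma> A B x t)"

definition Rn :: "real \<Rightarrow> real \<Rightarrow> real \<Rightarrow> real \<Rightarrow> real \<Rightarrow> nat \<Rightarrow> real \<Rightarrow> real" where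
  "Rn \<alpha> \<beta> \<gamma> A B n t =
     \<beta> / hn \<alpha> \<beta> \<gamma> A B n t *
     integral {0..1} (\<lambda>y. (poly (monic_OP \<alpha> \<beta> \<gamma> A B n t) y)\<^sup>2 * pvi_weight \<alpha> \<beta> \<gamma> A B y t / (1 - y))"

definition Sn :: "real \<Rightarrow> real \<Rightarrow> real \<Rightarrow> real \<Rightarrow> real \<Rightarrow> nat \<Rightarrow> real \<Rightarrow> real" where
  "Sn \<alpha> \<beta> \<gamma> A B n t =
     (t - 1) * Rn \<alpha> \<beta> \<gamma> A B n t / (2 * real n + \<alpha> + \<beta> + \<gamma> + 1) + 1"

end

(* The ladder-operator picture behind the statement: write a_0, a_1, a_t = 0, 1, t for the singular
   points, P = P_n, Q = P_(n+1), and let U_a f be the integral of f w / (x - a).  Integrating (f w)'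
   gives linear relations between the U_a f, while differentiating in t gives
   (d/dt) int f w = - gamma U_t f.  Orthogonality turns the time derivatives of P and Q into a
   Christoffel-Darboux kernel at t, so the nine numbers U_a (P P), U_a (P Q), U_a (Q Q) satisfy the
   Schlesinger equations.  Since U_a (P f) = f(a) U_a P for deg f <= n, they moreover satisfy
   U_a (P P) U_a (Q Q) = U_a (P Q) (U_a (P Q) - h_n).  Up to normalisation S_n is t U_0 (P P), and
   the equation for S_n'' follows by elimination. *)

theory Submission
  imports Defs
begin

section \<open>An algebraic form of Painleve VI\<close>

text \<open>The analytic obstacle: for \<gamma> < 1 the t-derivative of the weight is unbounded at a
  point that moves with t. Hence no integral with a pole is differentiated directly. Only integrals
  of polynomials are, and those with a pole at 0 or 1 are recovered from them through integration by
  parts. On the algebraic side, pairing P_n with P_(n+1) instead of P_(n-1) lets n = 0 go through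
  like any other n. Three sum relations and three determinants leave three of the nine numbers free:
  S_n and two combinations \<open>K\<close>, \<open>M\<close> of the U_a (P Q). S_n' fixes one
  combination of \<open>K\<close> and \<open>M\<close>, and the elimination succeeds because S_n''
  depends on them only through that one. The constant 2n + \<alpha> + \<beta> + \<gamma> + 1 is, up
  to sign, a weighted sum of the U_a (P P), read off from (x P^2)'.\<close>

text \<open>To be read with \<open>y\<close>, \<open>z\<close> as S_n and S_n', \<open>v0\<close>
  and \<open>v1\<close> as the derivatives of \<open>V\<close> at 0 and 1, and \<open>A0\<close>,
  \<open>A1\<close>, \<open>At\<close> as the products X Z at the three points. The left side is
  then S_n'' from the quotient rule, and the identity trades the free \<open>K\<close> and
  \<open>M\<close> for \<open>z\<close>.\<close>

lemma painleve_VI_algebra: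
  fixes y t K M \<kappa> \<alpha> \<beta> \<gamma> :: real
  assumes nz: "y \<noteq> 0" "y \<noteq> 1" "y \<noteq> t" "t \<noteq> 0" "t \<noteq> 1"
  defines "A0 \<equiv> (M\<^sup>2 - \<alpha>\<^sup>2) / 4" and "A1 \<equiv> ((M - K - \<kappa>)\<^sup>2 - \<beta>\<^sup>2) / 4" and "At \<equiv> ((K - 1)\<^sup>2 - \<gamma>\<^sup>2) / 4"
  defines "z \<equiv> ((t - 1) * y * K + (y - t) * M - \<kappa> * y * (y - t)) / (t * (t - 1))"
  defines "v0 \<equiv> ((t - 1) * y * At / (y - t) - (y - t) * A0 / ((t - 1) * y)) / t"
    and "v1 \<equiv> ((y - t) * A1 / (t * (y - 1)) - t * (y - 1) * At / (y - t)) / (t - 1)"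
  shows "(y * K + (t - 1) * z * K - 2 * (t - 1) * y * (v0 + v1) + (z - 1) * M - 2 * (y - t) * v0
      - \<kappa> * z * (y - t) - \<kappa> * y * (z - 1) - (2 * t - 1) * z) / (t * (t - 1)) =
    1/2 * (1 / y + 1 / (y - 1) + 1 / (y - t)) * z\<^sup>2 - (1 / t + 1 / (t - 1) + 1 / (y - t)) * z
    + y * (y - 1) * (y - t) / (t\<^sup>2 * (t - 1)\<^sup>2) *
      (\<kappa>\<^sup>2 / 2 + - (\<alpha>\<^sup>2 / 2) * t / y\<^sup>2 + \<beta>\<^sup>2 / 2 * (t - 1) / (y - 1)\<^sup>2
       + (1 - \<gamma>\<^sup>2) / 2 * t * (t - 1) / (y - t)\<^sup>2)"
proof -
  have d: "y - 1 \<noteq> 0" "y - t \<noteq> 0" "t - 1 \<noteq> 0" using nz by auto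
  \<comment> \<open>\<open>K\<close>, \<open>M\<close> and \<open>\<kappa>\<close> are polynomials in \<open>k, r, s\<close>, and \<open>z\<close> is a multiple of \<open>s\<close>.\<close>
  define c where "c = y * (y - 1) * (y - t) / (t\<^sup>2 * (t - 1)\<^sup>2)"
  define k where "k = K / (y - t)"
  define m where "m = M / y"
  define r where "r = (M - K - \<kappa>) / (y - 1)"
  define s where "s = k - m + r"
  have K: "K = k * (y - t)" and M: "M = m * y" and r: "M - K - \<kappa> = r * (y - 1)"
    using nz d by (simp_all add: k_def m_def r_def)
  have m: "m = k + r - s" by (simp add: s_def)
  have \<kappa>: "\<kappa> = k * t + r - y * s" using r unfolding K M m by algebra
  have "(t - 1) * y * K + (y - t) * M - \<kappa> * y * (y - t) = y * (y - 1) * (y - t) * s"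
    unfolding K M m \<kappa> by algebra
  then have z: "z = y * (y - 1) * (y - t) * s / (t * (t - 1))" by (simp add: z_def)
  \<comment> \<open>The squares of \<open>m\<close>, \<open>r\<close>, \<open>k\<close> produced
    here are cancelled in \<open>coeffs\<close> by the leading parts of \<open>A0\<close>,
    \<open>A1\<close>, \<open>At\<close>; this is the purpose of dividing M, M - K - \<kappa> and K
    by y, y - 1 and y - t.\<close>
  have quad: "s * ((t - 1) * K + M - \<kappa> * (2 * y - t)) =
      ((y - 1) * (y - t) + y * (y - t) + y * (y - 1)) * s\<^sup>2 / 2
      + (\<kappa>\<^sup>2 - t * m\<^sup>2 + (t - 1) * r\<^sup>2 - t * (t - 1) * k\<^sup>2) / 2"
    unfolding K M m \<kappa> by (simp add: power2_eq_square field_simps)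
  have lin: "y * K - M + \<kappa> * y = y * (y - 1) * (k - s)"
    unfolding K M m \<kappa> by algebra
  have sums: "1 / y + 1 / (y - 1) + 1 / (y - t) =
      ((y - 1) * (y - t) + y * (y - t) + y * (y - 1)) / (y * (y - 1) * (y - t))"
    "1 / t + 1 / (t - 1) = (2 * t - 1) / (t * (t - 1))"
    using nz d by (simp_all add: divide_simps) (simp_all add: algebra_simps)
  have zz: "1/2 * (((y - 1) * (y - t) + y * (y - t) + y * (y - 1)) / (y * (y - 1) * (y - t))) * z\<^sup>2 =
      c * (((y - 1) * (y - t) + y * (y - t) + y * (y - 1)) * s\<^sup>2 / 2)"
  proof -
    have "1/2 * (w / e) * (e * s / T)\<^sup>2 = e / T\<^sup>2 * (w * s\<^sup>2 / 2)" if "e \<noteq> 0" for w e T :: real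
      using that by (simp add: power2_eq_square mult_ac)
    from this[of "y * (y - 1) * (y - t)"] show ?thesis
      unfolding z c_def using nz d by (simp add: power_mult_distrib)
  qed
  have zs: "z * ((t - 1) * K + M - \<kappa> * (2 * y - t)) / (t * (t - 1)) = c * (s * ((t - 1) * K + M - \<kappa> * (2 * y - t)))"
    unfolding z c_def by (simp add: power2_eq_square mult_ac)
  have kt: "c * (k * t * (t - 1) / (y - t)) = y * (y - 1) * k / (t * (t - 1))"
    unfolding c_def using nz d by (simp add: power2_eq_square mult_ac)
  have st: "1 / (y - t) * z = y * (y - 1) * s / (t * (t - 1))"
    unfolding z using d by simp
  have "(y * K + (t - 1) * z * K + (z - 1) * M - \<kappa> * z * (y - t) - \<kappa> * y * (z - 1) - (2 * t - 1) * z) / (t * (t - 1))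
     = (z * ((t - 1) * K + M - \<kappa> * (2 * y - t)) + (y * K - M + \<kappa> * y) - (2 * t - 1) * z) / (t * (t - 1))"
    by (rule arg_cong[of _ _ "\<lambda>x. x / (t * (t - 1))"]) algebra
  also have "\<dots> = c * (s * ((t - 1) * K + M - \<kappa> * (2 * y - t)))
      + y * (y - 1) * (k - s) / (t * (t - 1)) - (2 * t - 1) / (t * (t - 1)) * z"
    unfolding add_divide_distrib diff_divide_distrib[of _ "(2 * t - 1) * z"] zs lin by (simp only: times_divide_eq_left)
  also have "\<dots> = 1/2 * (1 / y + 1 / (y - 1) + 1 / (y - t)) * z\<^sup>2 - (1 / t + 1 / (t - 1) + 1 / (y - t)) * z
    + c * ((\<kappa>\<^sup>2 - t * m\<^sup>2 + (t - 1) * r\<^sup>2 - t * (t - 1) * k\<^sup>2) / 2 + k * t * (t - 1) / (y - t))"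
  proof -
    have aux: "c * (a + b) + (e1 - e2) - q * z = 1/2 * p * z\<^sup>2 - (q + g) * z + c * (b + j)"
      if "1/2 * p * z\<^sup>2 = c * a" "g * z = e2" "c * j = e1" for a b e1 e2 q p g j
      unfolding that(1) that(2)[symmetric] that(3)[symmetric] by (simp add: algebra_simps)
    show ?thesis
      unfolding sums quad right_diff_distrib[of "y * (y - 1)" k s] diff_divide_distrib[of _ _ "t * (t - 1)"]
      by (rule aux[OF zz st kt])
  qed
  finally have main: "(y * K + (t - 1) * z * K + (z - 1) * M - \<kappa> * z * (y - t) - \<kappa> * y * (z - 1) - (2 * t - 1) * z) / (t * (t - 1)) = \<dots>" .
  have A0: "2 * (y - 1) / (t - 1) * ((y - t) * A0 / ((t - 1) * y) / t) = c * (2 * A0 * t / y\<^sup>2)"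
    unfolding c_def using nz d by (simp add: power2_eq_square divide_simps) (simp add: algebra_simps)?
  have A1: "2 * y / t * ((y - t) * A1 / (t * (y - 1)) / (t - 1)) = c * (2 * A1 * (t - 1) / (y - 1)\<^sup>2)"
    unfolding c_def using nz d by (simp add: power2_eq_square divide_simps) (simp add: algebra_simps)?
  have At: "2 * y / t * (t * (y - 1) * At / (y - t) / (t - 1)) - 2 * (y - 1) / (t - 1) * ((t - 1) * y * At / (y - t) / t)
     = c * (2 * At * t * (t - 1) / (y - t)\<^sup>2)"
  proof -
    have "2 * y / t * (t * (y - 1) * At / (y - t) / (t - 1)) = 2 * y * (y - 1) * At / (y - t) * (1 / (t - 1))"
      using nz d by (simp add: divide_simps)
    moreover have "2 * (y - 1) / (t - 1) * ((t - 1) * y * At / (y - t) / t) = 2 * y * (y - 1) * At / (y - t) * (1 / t)"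
      using nz d by (simp add: divide_simps)
    ultimately have "2 * y / t * (t * (y - 1) * At / (y - t) / (t - 1)) - 2 * (y - 1) / (t - 1) * ((t - 1) * y * At / (y - t) / t)
      = 2 * y * (y - 1) * At / (y - t) * (1 / (t - 1) - 1 / t)"
      by (simp only: right_diff_distrib)
    also have "1 / (t - 1) - 1 / t = 1 / (t * (t - 1))" using nz d by (simp add: divide_simps)
    finally show ?thesis unfolding c_def using nz d by (simp add: power2_eq_square divide_simps) (simp add: algebra_simps)?
  qed
  have v: "- (2 * (y - 1) / (t - 1)) * v0 - 2 * y / t * v1 =
    c * (2 * A0 * t / y\<^sup>2 - 2 * A1 * (t - 1) / (y - 1)\<^sup>2 + 2 * At * t * (t - 1) / (y - t)\<^sup>2)"
  proof -
    have aux: "- p * (a - b) - q * (d - e) = c * (a0 - a1 + a2)"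
      if "p * b = c * a0" "q * d = c * a1" "q * e - p * a = c * a2" for p q a b d e a0 a1 a2
      unfolding distrib_left right_diff_distrib that[symmetric] by simp
    show ?thesis
      unfolding v0_def v1_def diff_divide_distrib[of _ _ t] diff_divide_distrib[of _ _ "t - 1"]
      by (rule aux[OF A0 A1 At])
  qed
  have "y * K + (t - 1) * z * K - 2 * (t - 1) * y * (v0 + v1) + (z - 1) * M - 2 * (y - t) * v0
      - \<kappa> * z * (y - t) - \<kappa> * y * (z - 1) - (2 * t - 1) * z =
     (y * K + (t - 1) * z * K + (z - 1) * M - \<kappa> * z * (y - t) - \<kappa> * y * (z - 1) - (2 * t - 1) * z)
     + (- (2 * (y - 1) / (t - 1)) * v0 - 2 * y / t * v1) * (t * (t - 1))"
    using nz d by (simp add: field_simps)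
  then have split: "(y * K + (t - 1) * z * K - 2 * (t - 1) * y * (v0 + v1) + (z - 1) * M - 2 * (y - t) * v0
      - \<kappa> * z * (y - t) - \<kappa> * y * (z - 1) - (2 * t - 1) * z) / (t * (t - 1)) =
     (y * K + (t - 1) * z * K + (z - 1) * M - \<kappa> * z * (y - t) - \<kappa> * y * (z - 1) - (2 * t - 1) * z) / (t * (t - 1))
     + (- (2 * (y - 1) / (t - 1)) * v0 - 2 * y / t * v1)"
    using nz d by (simp only: add_divide_distrib) simp
  have coeffs: "(\<kappa>\<^sup>2 - t * m\<^sup>2 + (t - 1) * r\<^sup>2 - t * (t - 1) * k\<^sup>2) / 2 + k * t * (t - 1) / (y - t)
    + (2 * A0 * t / y\<^sup>2 - 2 * A1 * (t - 1) / (y - 1)\<^sup>2 + 2 * At * t * (t - 1) / (y - t)\<^sup>2) =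
     \<kappa>\<^sup>2 / 2 + - (\<alpha>\<^sup>2 / 2) * t / y\<^sup>2 + \<beta>\<^sup>2 / 2 * (t - 1) / (y - 1)\<^sup>2
       + (1 - \<gamma>\<^sup>2) / 2 * t * (t - 1) / (y - t)\<^sup>2"
  proof -
    have "2 * A0 * t / y\<^sup>2 = t * m\<^sup>2 / 2 - \<alpha>\<^sup>2 / 2 * t / y\<^sup>2"
      unfolding A0_def m_def power_divide using nz by (simp add: field_simps)
    moreover have "2 * A1 * (t - 1) / (y - 1)\<^sup>2 = (t - 1) * r\<^sup>2 / 2 - \<beta>\<^sup>2 / 2 * (t - 1) / (y - 1)\<^sup>2"
      unfolding A1_def r_def power_divide
      by (simp add: diff_divide_distrib left_diff_distrib right_diff_distrib mult_ac)
    moreover have "2 * At * t * (t - 1) / (y - t)\<^sup>2 + k * t * (t - 1) / (y - t) = t * (t - 1) * k\<^sup>2 / 2 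
      + (1 - \<gamma>\<^sup>2) / 2 * t * (t - 1) / (y - t)\<^sup>2"
    proof -
      \<comment> \<open>The term linear in \<open>K\<close> cancels against the one in (K - 1)^2,
        and the constant left over is the 1 in 1 - \<gamma>^2.\<close>
      have "2 * At + K = K\<^sup>2 / 2 + (1 - \<gamma>\<^sup>2) / 2" unfolding At_def by (simp add: power2_eq_square field_simps)
      moreover have "k * t * (t - 1) / (y - t) = K * (t * (t - 1) / (y - t)\<^sup>2)" "k\<^sup>2 = K\<^sup>2 / (y - t)\<^sup>2"
        by (simp_all add: k_def power_divide power2_eq_square mult_ac)
      moreover have "2 * At * t * (t - 1) / (y - t)\<^sup>2 = 2 * At * (t * (t - 1) / (y - t)\<^sup>2)" by simp
      ultimately have "2 * At * t * (t - 1) / (y - t)\<^sup>2 + k * t * (t - 1) / (y - t) =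
        (K\<^sup>2 / 2 + (1 - \<gamma>\<^sup>2) / 2) * (t * (t - 1) / (y - t)\<^sup>2)"
        by (simp only: distrib_right[symmetric])
      also have "\<dots> = t * (t - 1) * (K\<^sup>2 / (y - t)\<^sup>2) / 2 + (1 - \<gamma>\<^sup>2) / 2 * t * (t - 1) / (y - t)\<^sup>2"
        unfolding distrib_right by (simp add: mult_ac)
      finally show ?thesis unfolding \<open>k\<^sup>2 = _\<close> .
    qed
    ultimately show ?thesis
      by (simp add: add_divide_distrib diff_divide_distrib)
  qed
  show ?thesis
    unfolding split main v coeffs[symmetric] c_def[symmetric] by (simp only: distrib_left add.assoc)
qed

section \<open>Polynomials depending on a parameter\<close>

text \<open>The degree bound is uniform in the parameter, so that a linear functional applied to
  \<open>p s\<close> is one fixed finite sum over monomials, to be differentiated term by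
  term.\<close>

definition poly_deriv_at :: "nat \<Rightarrow> (real \<Rightarrow> real poly) \<Rightarrow> real poly \<Rightarrow> real \<Rightarrow> bool" where
  "poly_deriv_at N p p' t \<longleftrightarrow> (\<forall>s. degree (p s) \<le> N) \<and>
     (\<forall>k. ((\<lambda>s. coeff (p s) k) has_real_derivative coeff p' k) (at t))"

lemma poly_deriv_at_degree:
  assumes "poly_deriv_at N p p' t"
  shows "degree p' \<le> N"
proof (rule degree_le, intro allI impI)
  fix k assume "N < k"
  then have "coeff (p s) k = 0" for s
    using assms by (intro coeff_eq_0) (auto simp: poly_deriv_at_def intro: le_less_trans)
  moreover have "((\<lambda>s. coeff (p s) k) has_real_derivative coeff p' k) (at t)"
    using assms by (simp add: poly_deriv_at_def)
  ultimately have "((\<lambda>s. 0) has_real_derivative coeff p' k) (at t)"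
    by simp
  from DERIV_unique[OF this DERIV_const] show "coeff p' k = 0" .
qed

lemma poly_deriv_at_const: "degree p \<le> N \<Longrightarrow> poly_deriv_at N (\<lambda>_. p) 0 t"
  by (simp add: poly_deriv_at_def)

lemma poly_deriv_at_diff:
  assumes "poly_deriv_at N p p' t" "poly_deriv_at N q q' t"
  shows "poly_deriv_at N (\<lambda>s. p s - q s) (p' - q') t"
  using assms by (auto simp: poly_deriv_at_def intro!: degree_diff_le derivative_eq_intros)

lemma poly_deriv_at_sum:
  assumes "\<And>j. j \<in> J \<Longrightarrow> poly_deriv_at N (p j) (p' j) t"
  shows "poly_deriv_at N (\<lambda>s. \<Sum>j\<in>J. p j s) (\<Sum>j\<in>J. p' j) t"
proof (cases "finite J")
  case True
  then show ?thesis
    using assms by (auto simp: poly_deriv_at_def coeff_sum intro!: degree_sum_le DERIV_sum)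
qed (simp add: poly_deriv_at_def)

lemma poly_deriv_at_smult:
  assumes "poly_deriv_at M p p' t" "M \<le> N" "(c has_real_derivative c') (at t)"
  shows "poly_deriv_at N (\<lambda>s. smult (c s) (p s)) (smult c' (p t) + smult (c t) p') t"
proof -
  have "degree (p s) \<le> N" for s using assms unfolding poly_deriv_at_def by (meson le_trans)
  then show ?thesis
    using assms le_trans[OF degree_smult_le] 
    by (auto simp: poly_deriv_at_def intro!: derivative_eq_intros)
qed

lemma poly_deriv_at_mult:
  assumes "poly_deriv_at M p p' t" "poly_deriv_at N q q' t"
  shows "poly_deriv_at (M + N) (\<lambda>s. p s * q s) (p' * q t + p t * q') t"
proof -
  have "degree (p s * q s) \<le> M + N" for s
    using degree_mult_le[of "p s" "q s"] assms unfolding poly_deriv_at_def by (meson add_mono le_trans)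
  moreover have "((\<lambda>s. \<Sum>i\<le>k. coeff (p s) i * coeff (q s) (k - i)) has_real_derivative
      (\<Sum>i\<le>k. coeff p' i * coeff (q t) (k - i) + coeff q' (k - i) * coeff (p t) i)) (at t)" for k
    by (intro DERIV_sum DERIV_mult) (use assms in \<open>auto simp: poly_deriv_at_def\<close>)
  ultimately show ?thesis
    by (simp add: poly_deriv_at_def coeff_mult sum.distrib mult.commute[of "coeff q' _" "coeff (p t) _"])
qed

lemma linear_functional_expand:
  fixes F :: "real poly \<Rightarrow> real"
  assumes "\<And>f g. F (f + g) = F f + F g" "\<And>c f. F (smult c f) = c * F f" "degree f \<le> N"
  shows "F f = (\<Sum>k\<le>N. coeff f k * F (monom 1 k))"
proof -
  have F0: "F 0 = 0" using assms(2)[of 0 0] by simp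
  have sum: "F (\<Sum>k\<in>S. g k) = (\<Sum>k\<in>S. F (g k))" if "finite S" for S :: "nat set" and g
    using that by induction (simp_all add: F0 assms(1))
  have "f = (\<Sum>k\<le>N. smult (coeff f k) (monom 1 k))"
    using poly_as_sum_of_monoms'[OF assms(3)] by (simp add: smult_monom)
  then have "F f = F (\<Sum>k\<le>N. smult (coeff f k) (monom 1 k))" by simp
  then show ?thesis by (simp add: sum assms(2))
qed

text \<open>A product rule for a varying functional applied to a varying polynomial, by expansion in
  monomials. Linearity is asked only on a neighbourhood \<open>S\<close>, since \<open>U_add\<close>
  is available only for parameters in the open unit interval.\<close>

lemma DERIV_functional_poly:
  fixes F :: "real \<Rightarrow> real poly \<Rightarrow> real"
  assumes p: "poly_deriv_at N p p' t" and S: "open S" "t \<in> S"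
    and F: "\<And>s f g. s \<in> S \<Longrightarrow> F s (f + g) = F s f + F s g" "\<And>s c f. s \<in> S \<Longrightarrow> F s (smult c f) = c * F s f"
    and G: "\<And>f g. G (f + g) = G f + G g" "\<And>c f. G (smult c f) = c * G f"
    and D: "\<And>f. ((\<lambda>s. F s f) has_real_derivative G f) (at t)"
  shows "((\<lambda>s. F s (p s)) has_real_derivative F t p' + G (p t)) (at t)"
proof -
  have d: "degree (p s) \<le> N" "degree p' \<le> N" for s
    using p poly_deriv_at_degree by (auto simp: poly_deriv_at_def)
  have "((\<lambda>s. \<Sum>k\<le>N. coeff (p s) k * F s (monom 1 k)) has_real_derivative
     (\<Sum>k\<le>N. coeff p' k * F t (monom 1 k) + G (monom 1 k) * coeff (p t) k)) (at t)"
    by (intro DERIV_sum DERIV_mult D) (use p in \<open>auto simp: poly_deriv_at_def\<close>)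
  moreover have "(\<Sum>k\<le>N. coeff p' k * F t (monom 1 k) + G (monom 1 k) * coeff (p t) k) = F t p' + G (p t)"
    using linear_functional_expand[of "F t" p' N] linear_functional_expand[of G "p t" N] d F S G
    by (simp add: sum.distrib mult.commute)
  moreover have "eventually (\<lambda>s. (\<Sum>k\<le>N. coeff (p s) k * F s (monom 1 k)) = F s (p s)) (nhds t)"
    using eventually_nhds_in_open[OF S]
  proof eventually_elim
    case (elim s)
    then show ?case using linear_functional_expand[of "F s" "p s" N] d F by simp
  qed
  ultimately show ?thesis by (simp add: DERIV_cong_ev)
qed

section \<open>Integrals against the weight\<close>

locale pvi =
  fixes \<alpha> \<beta> \<gamma> A B :: real
  assumes exps_pos: "\<alpha> > 0" "\<beta> > 0" "\<gamma> > 0"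
    and AB: "A \<ge> 0" "A + B \<ge> 0" "\<not> (A = 0 \<and> A + B = 0)"
begin

text \<open>This is |s|^\<gamma> (A + B \<theta>(s)), written so that continuity at 0 and
  homogeneity of degree \<gamma> are immediate.\<close>

definition jump :: "real \<Rightarrow> real" where
  "jump s = A * max 0 (- s) powr \<gamma> + (A + B) * max 0 s powr \<gamma>"

abbreviation w :: "real \<Rightarrow> real \<Rightarrow> real" where
  "w x t \<equiv> pvi_weight \<alpha> \<beta> \<gamma> A B x t"

lemma w_eq: "w x t = x powr \<alpha> * (1 - x) powr \<beta> * jump (x - t)"
  by (auto simp: pvi_weight_def jump_def heaviside_def max_def)

lemma jump_nonneg: "jump s \<ge> 0"
  using AB by (simp add: jump_def)

lemma jump_scale: "c > 0 \<Longrightarrow> jump (c * s) = c powr \<gamma> * jump s"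
proof -
  assume c: "c > 0"
  have "max 0 (c * r) = c * max 0 r" for r
    using c by (auto simp: max_def zero_le_mult_iff mult_le_0_iff)
  from this[of s] this[of "-s"] show ?thesis
    using c by (simp add: jump_def powr_mult algebra_simps)
qed

lemma continuous_jump: "continuous_on X jump"
  unfolding jump_def using exps_pos
  by (intro continuous_intros continuous_on_powr') auto

lemma continuous_w: "continuous_on {0..1} (\<lambda>x. w x t)"
proof -
  have "continuous_on {0..1} (\<lambda>x. jump (x - t))"
    by (rule continuous_on_compose2[OF continuous_jump[of UNIV]]) (auto intro!: continuous_intros)
  then show ?thesis
    unfolding w_eq using exps_pos
    by (intro continuous_intros continuous_on_powr') auto
qed

lemma w_zero [simp]: "w 0 t = 0" "w 1 t = 0" "w t t = 0"
  by (auto simp: pvi_weight_def)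

lemma w_nonneg: "w x t \<ge> 0"
  using jump_nonneg by (simp add: w_eq)

lemma DERIV_w:
  assumes "0 < x" "x < 1" "x \<noteq> t"
  shows "((\<lambda>x. w x t) has_real_derivative w x t * (\<alpha> / x + \<beta> / (x - 1) + \<gamma> / (x - t))) (at x)"
proof -
  \<comment> \<open>Near x the sign of x - t and the Heaviside factor are constant; with both frozen
    the weight becomes a smooth product.\<close>
  define s where "s = sgn (x - t)"
  define c where "c = (if x > t then A + B else A)"
  have D: "((\<lambda>x. x powr \<alpha> * (1 - x) powr \<beta> * ((s * (x - t)) powr \<gamma> * c)) has_real_derivative
      w x t * (\<alpha> / x + \<beta> / (x - 1) + \<gamma> / (x - t))) (at x)"
  proof -
    have sp: "s * (x - t) > 0" and ss: "s \<noteq> 0" "s = 1 \<or> s = -1"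
      using assms by (auto simp: s_def sgn_if)
    have wx: "w x t = x powr \<alpha> * (1 - x) powr \<beta> * ((s * (x - t)) powr \<gamma> * c)"
      using assms by (auto simp: w_eq jump_def s_def c_def sgn_if max_def)
    have D1: "((\<lambda>x. x powr \<alpha>) has_real_derivative x powr \<alpha> * (\<alpha> / x)) (at x)"
      using assms by (auto intro!: derivative_eq_intros simp: powr_diff)
    have D2: "((\<lambda>x. (1 - x) powr \<beta>) has_real_derivative (1 - x) powr \<beta> * (\<beta> / (x - 1))) (at x)"
      using assms by (auto intro!: derivative_eq_intros simp: powr_diff divide_simps algebra_simps)
    have D3: "((\<lambda>x. (s * (x - t)) powr \<gamma>) has_real_derivative (s * (x - t)) powr \<gamma> * (\<gamma> / (x - t))) (at x)"
      using sp ss by (auto intro!: derivative_eq_intros simp: powr_diff divide_simps algebra_simps)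
    show ?thesis
      unfolding wx by (rule DERIV_cong[OF DERIV_mult[OF DERIV_mult[OF D1 D2] DERIV_mult[OF D3 DERIV_const]]])
        (simp add: algebra_simps)
  qed
  have ev: "eventually (\<lambda>z. z \<in> (if x > t then {t<..} else {..<t})) (nhds x)"
    using assms by (intro eventually_nhds_in_open) auto
  have "eventually (\<lambda>z. z powr \<alpha> * (1 - z) powr \<beta> * ((s * (z - t)) powr \<gamma> * c) = w z t) (nhds x)"
    using ev by eventually_elim (use assms in \<open>auto simp: w_eq jump_def s_def c_def sgn_if max_def split: if_splits\<close>)
  from DERIV_cong_ev[OF refl this refl] D show ?thesis by simp
qed

text \<open>The integrand is (f w)'. Since w need not be differentiable at t, the fundamental
  theorem is applied on [0,t] and [t,1] separately; the boundary terms vanish because w is 0 at 0, t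
  and 1. The integrand may be unbounded, so its integrability is part of the gain.\<close>

lemma pearson_has_integral:
  assumes "0 < t" "t < 1"
  shows "((\<lambda>x. poly (pderiv f) x * w x t + poly f x * w x t * (\<alpha> / x + \<beta> / (x - 1) + \<gamma> / (x - t)))
    has_integral 0) {0..1}"
proof -
  let ?g = "\<lambda>x. poly (pderiv f) x * w x t + poly f x * w x t * (\<alpha> / x + \<beta> / (x - 1) + \<gamma> / (x - t))"
  have *: "(?g has_integral (poly f b * w b t - poly f a * w a t)) {a..b}"
    if ab: "0 \<le> a" "a \<le> b" "b \<le> 1" "t \<notin> {a<..<b}" for a b
  proof (rule fundamental_theorem_of_calculus_interior)
    show "continuous_on {a..b} (\<lambda>x. poly f x * w x t)"
      using ab by (intro continuous_intros continuous_on_subset[OF continuous_w]) auto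
    show "((\<lambda>x. poly f x * w x t) has_vector_derivative ?g x) (at x)" if "x \<in> {a<..<b}" for x
    proof -
      have "0 < x" "x < 1" "x \<noteq> t" using that ab by auto
      from DERIV_mult[OF poly_DERIV DERIV_w[OF this]] show ?thesis
        by (simp add: has_real_derivative_iff_has_vector_derivative[symmetric] mult_ac)
    qed
  qed (use ab in auto)
  have "(?g has_integral (0 + 0)) {0..1}"
    by (rule has_integral_combine[where c = t]) (use assms *[of 0 t] *[of t 1] in auto)
  then show ?thesis by simp
qed

definition L :: "real \<Rightarrow> real poly \<Rightarrow> real" where
  "L t f = integral {0..1} (\<lambda>x. poly f x * w x t)"

definition U :: "real \<Rightarrow> real \<Rightarrow> real poly \<Rightarrow> real" where
  "U t a f = integral {0..1} (\<lambda>x. poly f x * w x t / (x - a))"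

lemma L_integrable: "(\<lambda>x. poly f x * w x t) integrable_on {0..1}"
  by (intro integrable_continuous_real continuous_intros continuous_w)

lemma L_add: "L t (f + g) = L t f + L t g"
  using integral_add[OF L_integrable L_integrable, of f t g t] by (simp add: L_def algebra_simps)

lemma L_smult: "L t (smult c f) = c * L t f"
  by (simp add: L_def mult.assoc)

text \<open>Integrability is extracted from \<open>pearson_has_integral\<close>: for f = (x - b)(x -
  c) the poles at b and c cancel, and the integrand is p (a - b)(a - c) w / (x - a) plus a
  polynomial multiple of w.\<close>

lemma w_integrable_div:
  assumes "0 < t" "t < 1" "a \<in> {0, 1, t}"
  shows "(\<lambda>x. w x t / (x - a)) integrable_on {0..1}"
proof -
  have *: "(\<lambda>x. w x t / (x - a)) integrable_on {0..1}"
    if "p > 0" "(a - b) * (a - c) \<noteq> 0" "w a t = 0" "w b t = 0" "w c t = 0"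
      "\<And>x. \<alpha> / x + \<beta> / (x - 1) + \<gamma> / (x - t) = p / (x - a) + q / (x - b) + r / (x - c)"
    for a b c p q r
  proof -
    let ?f = "[:-b, 1:] * [:-c, 1:] :: real poly"
    have i1: "(\<lambda>x. poly (pderiv ?f) x * w x t + poly ?f x * w x t * (p / (x - a) + q / (x - b) + r / (x - c)))
      integrable_on {0..1}"
      using pearson_has_integral[OF assms(1,2), of ?f] that(6) by (auto simp: integrable_on_def)
    \<comment> \<open>The polynomial part of that integrand; its last summand comes from (x - b)(x -
      c) = (a - b)(a - c) + (x - a)(x + a - b - c).\<close>
    let ?g = "pderiv ?f + smult q [:-c, 1:] + smult r [:-b, 1:] + smult p [:a - b - c, 1:]"
    have e: "w x t / (x - a) =
      (1 / (p * ((a - b) * (a - c)))) * ((poly (pderiv ?f) x * w x t + poly ?f x * w x t * (p / (x - a) + q / (x - b) + r / (x - c)))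
        - poly ?g x * w x t)" for x
    proof (cases "x = a \<or> x = b \<or> x = c")
      case True
      then show ?thesis using that by auto
    next
      case False
      have q: "poly ?f x * (q / (x - b)) = q * (x - c)" "poly ?f x * (r / (x - c)) = r * (x - b)"
        using False by (simp_all add: field_simps)
      have p: "poly ?f x * (p / (x - a)) = p * ((a - b) * (a - c)) * (1 / (x - a)) + p * (x + a - b - c)"
        using False by (simp add: field_simps)
      have g: "poly ?g x = poly (pderiv ?f) x + q * (x - c) + r * (x - b) + p * (x + a - b - c)"
        by (simp del: pderiv.simps mult_pCons_left add: pderiv_mult algebra_simps)
      have "p * ((a - b) * (a - c)) * (w x t / (x - a)) =
        w x t * (poly (pderiv ?f) x + (poly ?f x * (p / (x - a)) + poly ?f x * (q / (x - b)) + poly ?f x * (r / (x - c)))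
          - poly ?g x)"
        unfolding q p g by simp
      also have "\<dots> = (poly (pderiv ?f) x * w x t + poly ?f x * w x t * (p / (x - a) + q / (x - b) + r / (x - c)))
          - poly ?g x * w x t"
        by (simp only: ring_distribs mult_ac)
      finally have *: "p * ((a - b) * (a - c)) * (w x t / (x - a)) = \<dots>" .
      have "p * ((a - b) * (a - c)) \<noteq> 0" using that(1,2) by simp
      then show ?thesis unfolding *[symmetric] by simp
    qed
    show ?thesis
      unfolding e by (intro integrable_on_mult_right integrable_diff i1 L_integrable)
  qed
  from assms(3) consider "a = 0" | "a = 1" | "a = t" by blast
  then show ?thesis
  proof cases
    case 1 then show ?thesis using *[of \<alpha> 0 1 t \<beta> \<gamma>] assms exps_pos by simp
  next
    case 2 then show ?thesis using *[of \<beta> 1 0 t \<alpha> \<gamma>] assms exps_pos by simp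
  next
    case 3 then show ?thesis using *[of \<gamma> t 0 1 \<alpha> \<beta>] assms exps_pos by simp
  qed
qed

lemma U_integrable:
  assumes "0 < t" "t < 1" "a \<in> {0, 1, t}"
  shows "(\<lambda>x. poly f x * w x t / (x - a)) integrable_on {0..1}"
proof -
  have w0: "w a t = 0" using assms by auto
  define g where "g = synthetic_div f a"
  have f: "f = [:-a, 1:] * g + [:poly f a:]"
    using synthetic_div_correct'[of a f] by (simp add: g_def add.commute)
  have "poly f x * w x t / (x - a) = poly g x * w x t + poly f a * (w x t / (x - a))" for x
    by (cases "x = a") (simp_all add: w0, subst f, simp add: field_simps)
  then show ?thesis
    by (simp only:) (intro integrable_add integrable_on_mult_right L_integrable w_integrable_div assms)
qed

lemma U_add:
  assumes "0 < t" "t < 1" "a \<in> {0, 1, t}"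
  shows "U t a (f + g) = U t a f + U t a g"
  using integral_add[OF U_integrable[OF assms] U_integrable[OF assms], of f g]
  by (simp add: U_def algebra_simps add_divide_distrib)

lemma U_smult: "U t a (smult c f) = c * U t a f"
  by (simp add: U_def mult.assoc flip: times_divide_eq_right)

text \<open>At \<open>x = a\<close> the integrand of \<open>U\<close> has the junk value 0, which is harmless since \<open>w a t = 0\<close>.\<close>

lemma U_mult_linear:
  assumes "a \<in> {0, 1, t}"
  shows "U t a ([:-a, 1:] * f) = L t f"
proof -
  have w0: "w a t = 0" using assms by auto
  have "poly ([:-a, 1:] * f) x * w x t / (x - a) = poly f x * w x t" for x
    by (cases "x = a") (simp_all add: w0 field_simps)
  then show ?thesis by (simp only: U_def L_def)
qed

lemma pearson:
  assumes "0 < t" "t < 1"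
  shows "L t (pderiv f) + \<alpha> * U t 0 f + \<beta> * U t 1 f + \<gamma> * U t t f = 0"
proof -
  have I: "((\<lambda>x. poly f x * w x t / (x - a)) has_integral U t a f) {0..1}" if "a \<in> {0, 1, t}" for a
    unfolding U_def using U_integrable[OF assms that] by (rule integrable_integral)
  have "((\<lambda>x. poly (pderiv f) x * w x t) has_integral L t (pderiv f)) {0..1}"
    unfolding L_def by (rule integrable_integral[OF L_integrable])
  from has_integral_add[OF has_integral_add[OF has_integral_add[OF this
      has_integral_mult_right[OF I, of 0 \<alpha>]] has_integral_mult_right[OF I, of 1 \<beta>]]
      has_integral_mult_right[OF I, of t \<gamma>]]
  have "((\<lambda>x. poly (pderiv f) x * w x t + poly f x * w x t * (\<alpha> / x + \<beta> / (x - 1) + \<gamma> / (x - t)))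
    has_integral (L t (pderiv f) + \<alpha> * U t 0 f + \<beta> * U t 1 f + \<gamma> * U t t f)) {0..1}"
    by (simp add: algebra_simps)
  with pearson_has_integral[OF assms, of f] show ?thesis
    using has_integral_unique by blast
qed

text \<open>The weight may vanish identically on one side of t, namely if A = 0 or A + B = 0. On the
  other side it is nonzero, and a polynomial vanishing on that interval is 0.\<close>

lemma L_pos:
  assumes "0 < t" "t < 1" "f \<noteq> 0"
  shows "L t (f * f) > 0"
proof (rule ccontr)
  assume "\<not> ?thesis"
  moreover have "L t (f * f) \<ge> 0"
    unfolding L_def by (rule integral_nonneg[OF L_integrable]) (use w_nonneg in simp)
  ultimately have "L t (f * f) = 0" by simp
  moreover have "continuous_on {0..1} (\<lambda>x. poly (f * f) x * w x t)"
    by (intro continuous_intros continuous_w)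
  ultimately have z: "poly (f * f) x * w x t = 0" if "x \<in> {0..1}" for x
    using integral_eq_0_iff[of 0 1 "\<lambda>x. poly (f * f) x * w x t"] that w_nonneg
    by (auto simp: L_def)
  have j: "A \<noteq> 0 \<Longrightarrow> s < 0 \<Longrightarrow> jump s \<noteq> 0" "A + B \<noteq> 0 \<Longrightarrow> s > 0 \<Longrightarrow> jump s \<noteq> 0" for s
    by (simp_all add: jump_def)
  obtain a b where ab: "0 \<le> a" "a < b" "b \<le> 1" "\<And>x. x \<in> {a<..<b} \<Longrightarrow> jump (x - t) \<noteq> 0"
  proof (cases "A = 0")
    case True
    show ?thesis by (rule that[of t 1]) (use True AB assms j in auto)
  next
    case False
    show ?thesis by (rule that[of 0 t]) (use False assms j in auto)
  qed
  have "poly f x = 0" if "x \<in> {a<..<b}" for x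
    using z[of x] ab that by (auto simp: w_eq)
  then have "{a<..<b} \<subseteq> {x. poly f x = 0}" by auto
  then have "finite {a<..<b}" using poly_roots_finite[OF assms(3)] finite_subset by blast
  then show False using ab infinite_Ioo[of a b] by simp
qed

text \<open>The integrals are differentiated in \<open>t\<close> after the Moebius substitution \<open>x = moeb t u\<close>, which
  fixes 0 and 1 and moves \<open>1/2\<close> to \<open>t\<close>: the singularities of the weight then no longer depend on \<open>t\<close>.\<close>

definition moeb_den :: "real \<Rightarrow> real \<Rightarrow> real" where
  "moeb_den t u = (1 - t) * (1 - u) + t * u"

definition moeb :: "real \<Rightarrow> real \<Rightarrow> real" where
  "moeb t u = t * u / moeb_den t u"

text \<open>The parameter-free factor of the transported weight; homogeneity of \<open>jump\<close>
  pushes everything that depends on t into powers of t, 1 - t and \<open>moeb_den\<close>.\<close>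

definition moeb_weight :: "real \<Rightarrow> real" where
  "moeb_weight u = u powr \<alpha> * (1 - u) powr \<beta> * jump (2 * u - 1)"

lemma moeb_den_pos:
  assumes "0 < t" "t < 1" "0 \<le> u" "u \<le> 1"
  shows "moeb_den t u > 0"
proof (cases "u = 0")
  case False
  then have "t * u > 0" "(1 - t) * (1 - u) \<ge> 0" using assms by auto
  then show ?thesis by (simp add: moeb_den_def)
qed (use assms in \<open>simp add: moeb_den_def\<close>)

lemma moeb_simps:
  assumes "0 < t" "t < 1" "0 \<le> u" "u \<le> 1"
  shows "1 - moeb t u = (1 - t) * (1 - u) / moeb_den t u"
    and "moeb t u - t = t * (1 - t) / moeb_den t u * (2 * u - 1)"
    and "0 \<le> moeb t u" "moeb t u \<le> 1"
proof -
  note E = moeb_den_pos[OF assms]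
  show 1: "1 - moeb t u = (1 - t) * (1 - u) / moeb_den t u"
    using E by (simp add: moeb_def field_simps) (simp add: moeb_den_def algebra_simps)
  show "moeb t u - t = t * (1 - t) / moeb_den t u * (2 * u - 1)"
    using E by (simp add: moeb_def field_simps) (simp add: moeb_den_def algebra_simps)
  show "0 \<le> moeb t u" using E assms by (simp add: moeb_def)
  have "1 - moeb t u \<ge> 0" unfolding 1 using E assms by simp
  then show "moeb t u \<le> 1" by simp
qed

lemma moeb_den_nonzero: "0 < t \<Longrightarrow> t < 1 \<Longrightarrow> 0 \<le> u \<Longrightarrow> u \<le> 1 \<Longrightarrow> moeb_den t u \<noteq> 0"
  using moeb_den_pos by force

lemma continuous_moeb_weight: "continuous_on {0..1} moeb_weight"
proof -
  have "continuous_on {0..1} (\<lambda>u. jump (2 * u - 1))"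
    by (rule continuous_on_compose2[OF continuous_jump[of UNIV]]) (auto intro!: continuous_intros)
  then show ?thesis
    unfolding moeb_weight_def using exps_pos
    by (intro continuous_intros continuous_on_powr') auto
qed

text \<open>Each of the three factors of the weight contributes its exponent, and the Jacobian t (1
  - t) / \<open>moeb_den\<close>^2 contributes the 2.\<close>

abbreviation moeb_exp :: real where "moeb_exp \<equiv> - (\<alpha> + \<beta> + \<gamma> + 2)"

lemma L_moeb:
  assumes "0 < t" "t < 1"
  shows "L t f = t powr (\<alpha> + \<gamma> + 1) * (1 - t) powr (\<beta> + \<gamma> + 1) *
    integral {0..1} (\<lambda>u. moeb_weight u * (poly f (moeb t u) * moeb_den t u powr moeb_exp))"
proof -
  let ?c = "t powr (\<alpha> + \<gamma> + 1) * (1 - t) powr (\<beta> + \<gamma> + 1)"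
  have D: "(moeb t has_field_derivative t * (1 - t) / (moeb_den t u)\<^sup>2) (at u within {0..1})"
    if "u \<in> {0..1}" for u
  proof -
    have "moeb_den t u \<noteq> 0" using moeb_den_nonzero assms that by simp
    then show ?thesis
      unfolding moeb_def moeb_den_def
      by (auto intro!: derivative_eq_intros simp: divide_simps power2_eq_square) (simp add: algebra_simps)
  qed
  have m01: "moeb t 0 = 0" "moeb t 1 = 1" using assms by (auto simp: moeb_def moeb_den_def)
  have "((\<lambda>u. (t * (1 - t) / (moeb_den t u)\<^sup>2) *\<^sub>R (poly f (moeb t u) * w (moeb t u) t)) has_integral
      (integral {moeb t 0..moeb t 1} (\<lambda>x. poly f x * w x t))) {0..1}"
  proof (rule has_integral_substitution[where c = 0 and d = 1])
    show "moeb t ` {0..1} \<subseteq> {0..1}" using moeb_simps(3,4)[OF assms] by auto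
    show "continuous_on {0..1} (\<lambda>x. poly f x * w x t)" by (intro continuous_intros continuous_w)
  qed (simp_all add: m01 D)
  then have I: "((\<lambda>u. (t * (1 - t) / (moeb_den t u)\<^sup>2) * (poly f (moeb t u) * w (moeb t u) t)) has_integral
      L t f) {0..1}" by (simp add: L_def m01)
  have eq: "(t * (1 - t) / (moeb_den t u)\<^sup>2) * (poly f (moeb t u) * w (moeb t u) t) =
      ?c * (moeb_weight u * (poly f (moeb t u) * moeb_den t u powr moeb_exp))" if u: "u \<in> {0..1}" for u
  proof -
    let ?E = "moeb_den t u"
    have u': "0 \<le> u" "u \<le> 1" using u by auto
    have E: "?E > 0" using moeb_den_pos assms u by simp
    have a: "moeb t u powr \<alpha> = t powr \<alpha> * u powr \<alpha> * ?E powr (- \<alpha>)"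
      using E assms u by (simp add: moeb_def powr_mult powr_divide powr_minus divide_inverse inverse_powr)
    have b: "(1 - moeb t u) powr \<beta> = (1 - t) powr \<beta> * (1 - u) powr \<beta> * ?E powr (- \<beta>)"
      using E assms u by (simp add: moeb_simps powr_mult powr_divide powr_minus divide_inverse inverse_powr)
    have "jump (moeb t u - t) = (t * (1 - t) / ?E) powr \<gamma> * jump (2 * u - 1)"
      unfolding moeb_simps(2)[OF assms u'] using E assms by (intro jump_scale) simp
    also have "(t * (1 - t) / ?E) powr \<gamma> = t powr \<gamma> * (1 - t) powr \<gamma> * ?E powr (- \<gamma>)"
      using E assms by (simp add: powr_mult powr_divide powr_minus divide_inverse inverse_powr)
    finally have g: "jump (moeb t u - t) = t powr \<gamma> * (1 - t) powr \<gamma> * ?E powr (- \<gamma>) * jump (2 * u - 1)" .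
    have q: "?E powr moeb_exp = ?E powr (- \<alpha>) * ?E powr (- \<beta>) * ?E powr (- \<gamma>) / ?E\<^sup>2"
    proof -
      have "moeb_exp = - \<alpha> + - \<beta> + - \<gamma> - 2" by simp
      then show ?thesis using E by (simp only: powr_add powr_diff) (simp add: powr_numeral)
    qed
    have t: "t powr (\<alpha> + \<gamma> + 1) = t powr \<alpha> * t powr \<gamma> * t"
       "(1 - t) powr (\<beta> + \<gamma> + 1) = (1 - t) powr \<beta> * (1 - t) powr \<gamma> * (1 - t)"
      using assms by (simp_all add: powr_add)
    show ?thesis
      unfolding w_eq a b g q t moeb_weight_def by (simp add: mult_ac)
  qed
  have "((\<lambda>u. ?c * (moeb_weight u * (poly f (moeb t u) * moeb_den t u powr moeb_exp))) has_integral L t f) {0..1}"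
    by (rule has_integral_eq[OF eq I])
  from integral_unique[OF this] show ?thesis
    unfolding integral_mult_right by (rule sym)
qed

text \<open>In the variable x = \<open>moeb t u\<close>, the parameter derivative of x is x (1 - x)
  / (t (1 - t)), and that of log \<open>moeb_den\<close> is (x - t) / (t (1 - t)). So
  differentiation under the integral sign again gives the integral of a polynomial against w, with
  no singular factor.\<close>

lemma DERIV_L_moeb:
  assumes "0 < t" "t < 1"
  shows "((\<lambda>t. L t f) has_real_derivative
    L t (smult ((\<alpha> + \<gamma> + 1) * (1 - t) - (\<beta> + \<gamma> + 1) * t) f + smult moeb_exp ([:-t, 1:] * f)
      + [:0, 1, -1:] * pderiv f) / (t * (1 - t))) (at t)"
proof -
  let ?c = "\<lambda>t. t powr (\<alpha> + \<gamma> + 1) * (1 - t) powr (\<beta> + \<gamma> + 1)"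
  let ?F = "\<lambda>t u. moeb_weight u * (poly f (moeb t u) * moeb_den t u powr moeb_exp)"
  let ?f' = "\<lambda>t. smult moeb_exp ([:-t, 1:] * f) + [:0, 1, -1:] * pderiv f"
  let ?F' = "\<lambda>t u. moeb_weight u * (poly (?f' t) (moeb t u) * moeb_den t u powr moeb_exp) / (t * (1 - t))"
  have D: "((\<lambda>t. ?F t u) has_field_derivative ?F' t u) (at t)" if "t \<in> {0<..<1}" "u \<in> {0..1}" for t u
  proof -
    have t: "0 < t" "t < 1" "0 \<le> u" "u \<le> 1" using that by auto
    note E = moeb_den_pos[OF t]
    have DE: "((\<lambda>t. moeb_den t u) has_field_derivative (2 * u - 1)) (at t)"
      unfolding moeb_den_def by (auto intro!: derivative_eq_intros)
    have "((\<lambda>t. moeb t u) has_field_derivative (u * moeb_den t u - t * u * (2 * u - 1)) / (moeb_den t u * moeb_den t u)) (at t)"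
      unfolding moeb_def using E by (auto intro!: derivative_eq_intros DE)
    also have "(u * moeb_den t u - t * u * (2 * u - 1)) / (moeb_den t u * moeb_den t u) = moeb t u * (1 - moeb t u) / (t * (1 - t))"
      unfolding moeb_simps(1)[OF t] using E t
      by (simp add: moeb_def field_simps) (simp add: moeb_den_def algebra_simps)
    finally have DM: "((\<lambda>t. moeb t u) has_field_derivative moeb t u * (1 - moeb t u) / (t * (1 - t))) (at t)" .
    have DP: "((\<lambda>t. moeb_den t u powr moeb_exp) has_field_derivative moeb_exp * moeb_den t u powr moeb_exp * (moeb t u - t) / (t * (1 - t))) (at t)"
    proof -
      have "((\<lambda>t. moeb_den t u powr moeb_exp) has_field_derivative (2 * u - 1) * (moeb_exp * moeb_den t u powr (moeb_exp - 1))) (at t)"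
        using has_real_derivative_powr[OF E, of moeb_exp] DE by (rule DERIV_chain2[THEN DERIV_cong]) (simp add: mult_ac)
      also have "(2 * u - 1) * (moeb_exp * moeb_den t u powr (moeb_exp - 1)) = moeb_exp * moeb_den t u powr moeb_exp * ((2 * u - 1) / moeb_den t u)"
        using E powr_diff[of "moeb_den t u" moeb_exp 1] by simp
      also have "(2 * u - 1) / moeb_den t u = (moeb t u - t) / (t * (1 - t))"
        unfolding moeb_simps(2)[OF t] using E t by simp
      finally show ?thesis by simp
    qed
    show ?thesis
      by (rule DERIV_cong[OF DERIV_mult[OF DERIV_const DERIV_mult[OF DERIV_chain2[OF poly_DERIV DM] DP]]])
        (simp add: algebra_simps add_divide_distrib diff_divide_distrib)
  qed
  have cE: "continuous_on ({0<..<1} \<times> {0..1}) (\<lambda>z. moeb_den (fst z) (snd z))"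
    unfolding moeb_den_def by (intro continuous_intros)
  have cM: "continuous_on ({0<..<1} \<times> {0..1}) (\<lambda>z. moeb (fst z) (snd z))"
    unfolding moeb_def by (intro continuous_intros cE) (use moeb_den_nonzero in auto)
  have cW: "continuous_on ({0<..<1} \<times> {0..1}) (\<lambda>z. moeb_weight (snd z))"
    by (rule continuous_on_compose2[OF continuous_moeb_weight]) (auto intro!: continuous_intros)
  have pf: "poly (?f' t) x = moeb_exp * ((x - t) * poly f x) + x * (1 - x) * poly (pderiv f) x" for t x
    by (simp add: algebra_simps)
  have "((\<lambda>t. integral (cbox 0 1) (?F t)) has_field_derivative integral (cbox 0 1) (?F' t)) (at t within {0<..<1})"
  proof (rule leibniz_rule_field_derivative)
    show "((\<lambda>t. ?F t u) has_field_derivative ?F' t u) (at t within {0<..<1})"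
      if "t \<in> {0<..<1}" "u \<in> cbox 0 1" for t u
      using D[of t u] that has_field_derivative_at_within by (simp add: cbox_interval)
    show "?F t integrable_on cbox 0 1" if "t \<in> {0<..<1}" for t
    proof -
      have cd: "continuous_on {0..1} (moeb_den t)"
        unfolding moeb_den_def by (intro continuous_intros)
      moreover have "continuous_on {0..1} (moeb t)"
        unfolding moeb_def using moeb_den_nonzero that by (intro continuous_intros cd) auto
      ultimately
      show ?thesis
        unfolding cbox_interval using moeb_den_nonzero that
        by (intro integrable_continuous_real continuous_on_mult continuous_moeb_weight continuous_on_powr
              continuous_on_poly continuous_on_const) auto
    qed
    show "continuous_on ({0<..<1} \<times> cbox 0 1) (\<lambda>(t, u). ?F' t u)"
      unfolding case_prod_unfold cbox_interval pf
    proof (intro continuous_on_divide continuous_on_mult continuous_on_add continuous_on_powr cW cM cE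
        continuous_on_poly continuous_on_const continuous_on_diff continuous_on_fst continuous_on_snd
        continuous_on_id ballI)
      fix z :: "real \<times> real" assume "z \<in> {0<..<1} \<times> {0..1}"
      then show "moeb_den (fst z) (snd z) \<noteq> 0" "fst z * (1 - fst z) \<noteq> 0"
        using moeb_den_nonzero by auto
    qed
  qed (simp_all add: assms convex_real_interval)
  then have DI: "((\<lambda>t. integral {0..1} (?F t)) has_field_derivative integral {0..1} (?F' t)) (at t)"
    using at_within_open[of t "{0<..<1}"] assms by (simp only: cbox_interval greaterThanLessThan_iff simp_thms open_greaterThanLessThan)
  have ring1: "(p * u) * q + (q * - v) * p = (p * q) * (u - v)"
    and ring2: "(p * u) * q + v * p = u * (p * q) + p * v" for p q u v :: real
    by (simp_all add: algebra_simps)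
  have Dc: "(?c has_field_derivative ?c t * ((\<alpha> + \<gamma> + 1) / t - (\<beta> + \<gamma> + 1) / (1 - t))) (at t)"
  proof -
    have D1: "((\<lambda>x. x powr r) has_real_derivative x powr r * (r / x)) (at x)" if "x > 0" for x r :: real
      using has_real_derivative_powr[OF that, of r] powr_diff[of x r 1] that by (simp add: mult_ac)
    have D2: "((\<lambda>x. (1 - x) powr r) has_real_derivative (1 - t) powr r * (- (r / (1 - t)))) (at t)" for r
    proof -
      have "((\<lambda>x. 1 - x) has_real_derivative -1) (at t)" by (auto intro!: derivative_eq_intros)
      from DERIV_chain2[OF D1[of "1 - t" r] this] show ?thesis using assms by simp
    qed
    show ?thesis by (rule DERIV_cong[OF DERIV_mult[OF D1[OF assms(1)] D2]]) (rule ring1)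
  qed
  have ev: "eventually (\<lambda>t. ?c t * integral {0..1} (?F t) = L t f) (nhds t)"
  proof -
    have "eventually (\<lambda>t. t \<in> {0<..<1}) (nhds t)" using assms by (intro eventually_nhds_in_open) auto
    then show ?thesis
    proof eventually_elim
      case (elim s)
      then show ?case using L_moeb[of s f] by (simp only: greaterThanLessThan_iff)
    qed
  qed
  have Lf': "?c t * integral {0..1} (?F' t) = L t (?f' t) / (t * (1 - t))"
    unfolding L_moeb[OF assms, of "?f' t"] integral_divide by (rule times_divide_eq_right)
  let ?d = "(\<alpha> + \<gamma> + 1) / t - (\<beta> + \<gamma> + 1) / (1 - t)"
  have "((\<lambda>t. ?c t * integral {0..1} (?F t)) has_real_derivative ?d * L t f + L t (?f' t) / (t * (1 - t))) (at t)"
    unfolding Lf'[symmetric] L_moeb[OF assms, of f]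
    by (rule DERIV_cong[OF DERIV_mult[OF Dc DI]]) (rule ring2)
  then have "((\<lambda>t. L t f) has_real_derivative ?d * L t f + L t (?f' t) / (t * (1 - t))) (at t)"
    by (rule DERIV_cong_ev[OF refl ev refl, THEN iffD1])
  moreover have "?d * L t f + L t (?f' t) / (t * (1 - t)) =
    L t (smult ((\<alpha> + \<gamma> + 1) * (1 - t) - (\<beta> + \<gamma> + 1) * t) f + ?f' t) / (t * (1 - t))"
    unfolding L_add[of t _ "?f' t"] L_smult using assms by (simp add: divide_simps)
  ultimately show ?thesis
    by (simp only: add.assoc[of "smult _ f" "smult _ _"])
qed

section \<open>Parameter derivatives of the integrals with and without a pole\<close>

text \<open>Formally the t-derivative of w is - \<gamma> w / (x - t). It is obtained from
  \<open>DERIV_L_moeb\<close> and \<open>pearson\<close> for x (x - 1) f: the factor x (x - 1)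
  removes the poles at 0 and 1 and leaves \<open>U\<close> at t as the only singular
  integral.\<close>

lemma DERIV_L:
  assumes "0 < t" "t < 1"
  shows "((\<lambda>t. L t f) has_real_derivative - \<gamma> * U t t f) (at t)"
proof -
  note P = pearson[OF assms, of "[:0, -1, 1:] * f"]
  have x: "[:0, -1, 1:] * f = [:- 0, 1:] * ([:-1, 1:] * f)" "[:0, -1, 1:] * f = [:-1, 1:] * ([:0, 1:] * f)"
    "[:0, -1, 1:] * f = smult (t * (t - 1)) f + [:-t, 1:] * ([:t - 1, 1:] * f)"
    by (simp_all add: poly_eq_poly_eq_iff[symmetric] fun_eq_iff algebra_simps)
  have U0: "U t 0 ([:0, -1, 1:] * f) = L t ([:-1, 1:] * f)"
    unfolding x(1) by (rule U_mult_linear) simp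
  have U1: "U t 1 ([:0, -1, 1:] * f) = L t ([:0, 1:] * f)"
    unfolding x(2) by (rule U_mult_linear) simp
  have Ut: "U t t ([:0, -1, 1:] * f) = t * (t - 1) * U t t f + L t ([:t - 1, 1:] * f)"
    unfolding x(3) using assms by (simp only: U_add U_smult U_mult_linear insert_iff simp_thms)
  have lin: "L t ([:c, 1:] * f) = c * L t f + L t ([:0, 1:] * f)" for c
  proof -
    have "[:c, 1:] * f = smult c f + [:0, 1:] * f" by (simp add: algebra_simps)
    then show ?thesis by (simp only: L_add L_smult)
  qed
  have pd: "L t (pderiv ([:0, -1, 1:] * f)) = 2 * L t ([:0, 1:] * f) - L t f - L t ([:0, 1, -1:] * pderiv f)"
  proof -
    have "pderiv ([:0, -1, 1:] * f) = smult 2 ([:0, 1:] * f) + smult (-1) f + smult (-1) ([:0, 1, -1:] * pderiv f)"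
      by (simp only: poly_eq_poly_eq_iff[symmetric] fun_eq_iff pderiv_mult poly_add poly_mult poly_smult)
        (simp add: pderiv_pCons algebra_simps)
    then show ?thesis by (simp only: L_add L_smult)
  qed
  have "L t (smult ((\<alpha> + \<gamma> + 1) * (1 - t) - (\<beta> + \<gamma> + 1) * t) f + smult moeb_exp ([:-t, 1:] * f)
      + [:0, 1, -1:] * pderiv f) = - \<gamma> * U t t f * (t * (1 - t))"
    using P unfolding U0 U1 Ut pd L_add L_smult lin[of "-1"] lin[of "-t"] lin[of "t-1"]
    by algebra
  with DERIV_L_moeb[OF assms, of f] assms show ?thesis by simp
qed

lemma U_split:
  assumes "0 < t" "t < 1" "a \<in> {0, 1, t}"
  shows "U t a f = poly f a * U t a 1 + L t (synthetic_div f a)"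
proof -
  have "f = [:-a, 1:] * synthetic_div f a + smult (poly f a) 1"
    using synthetic_div_correct'[of a f] by (simp add: add.commute one_pCons)
  then have "U t a f = U t a ([:-a, 1:] * synthetic_div f a + smult (poly f a) 1)" by simp
  then show ?thesis
    by (simp only: U_add[OF assms] U_mult_linear[OF assms(3)] U_smult)
qed

text \<open>The right side is what the formal rule yields after splitting 1 / ((x - a)(x - t)) into
  partial fractions. It is proved by writing \<open>U t a 1\<close> as a rational expression in the
  moments of 1 and x, which \<open>DERIV_L\<close> can differentiate. The parameters
  \<open>b\<close>, \<open>p\<close>, \<open>q\<close> treat both endpoints at once.\<close>

lemma DERIV_U_1:
  fixes a b p q :: real
  assumes "0 < t" "t < 1" "a = 0 \<and> b = 1 \<and> p = \<alpha> \<and> q = \<beta> \<or> a = 1 \<and> b = 0 \<and> p = \<beta> \<and> q = \<alpha>"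
  shows "((\<lambda>t. U t a 1) has_real_derivative - \<gamma> * (U t a 1 - U t t 1) / (a - t)) (at t)"
proof -
  have p: "p \<noteq> 0" "a - b \<noteq> 0" "a - t \<noteq> 0" using assms exps_pos by auto
  \<comment> \<open>The coefficients come from \<open>pearson\<close> with f = (x - b)(x - s), for
    which only the pole at a survives.\<close>
  let ?N = "\<lambda>s. (2 + p + q + \<gamma>) * L s [:0, 1:] + (- b - s + p * (a - b - s) - q * s - \<gamma> * b) * L s 1"
  have lin: "L s [:c, 1:] = c * L s 1 + L s [:0, 1:]" "L s [:c, 2:] = c * L s 1 + 2 * L s [:0, 1:]" for s c
  proof -
    have "[:c, 1:] = smult c 1 + [:0, 1:]" "[:c, 2:] = smult c 1 + smult 2 [:0, 1:]" by simp_all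
    then show "L s [:c, 1:] = c * L s 1 + L s [:0, 1:]" "L s [:c, 2:] = c * L s 1 + 2 * L s [:0, 1:]"
      by (simp_all only: L_add L_smult)
  qed
  have P: "L s (pderiv f) + p * U s a f + q * U s b f + \<gamma> * U s s f = 0" if "0 < s" "s < 1" for s f
    using pearson[OF that, of f] assms(3) by auto
  have eqK: "U s a 1 * (p * (a - b) * (a - s)) = - ?N s" if s: "0 < s" "s < 1" for s
  proof -
    let ?f = "[:-b, 1:] * [:-s, 1:]"
    have as: "a - s \<noteq> 0" "a \<in> {0, 1, s}" "b \<in> {0, 1, s}" using s assms(3) by auto
    have f2: "?f = [:-s, 1:] * [:-b, 1:]"
      "?f = [:-a, 1:] * [:a - b - s, 1:] + smult ((a - b) * (a - s)) 1" by (simp_all add: algebra_simps one_pCons)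
    have pd: "pderiv ?f = [:- b - s, 2:]" by (simp add: pderiv_pCons pderiv_mult)
    have Ub: "U s b ?f = L s [:-s, 1:]" by (rule U_mult_linear[OF as(3)])
    have Us: "U s s ?f = L s [:-b, 1:]" unfolding f2(1) by (rule U_mult_linear) simp
    have Ua: "U s a ?f = L s [:a - b - s, 1:] + (a - b) * (a - s) * U s a 1"
      unfolding f2(2) by (simp only: U_add[OF s as(2)] U_smult U_mult_linear[OF as(2)])
    show ?thesis
      using P[OF s, of ?f] unfolding pd Ub Us Ua lin[of s "- b - s"] lin[of s "-s"] lin[of s "-b"] lin[of s "a-b-s"]
      by algebra
  qed
  have eqN: "U s a 1 = - ?N s / (p * (a - b) * (a - s))" if s: "0 < s" "s < 1" for s
  proof -
    have nz: "p * (a - b) * (a - s) \<noteq> 0" using p s assms(3) by auto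
    from eq_divide_imp[OF nz eqK[OF s]] show ?thesis .
  qed
  have Utx: "U t t [:0, 1:] = t * U t t 1 + L t 1"
  proof -
    have "[:0, 1:] = [:-t, 1:] * 1 + smult t 1" by (simp add: one_pCons)
    then show ?thesis using assms by (simp only: U_add U_smult U_mult_linear insert_iff simp_thms)
  qed
  let ?N' = "- \<gamma> * ((2 + p + q + \<gamma>) * U t t [:0, 1:] + (- b - t + p * (a - b - t) - q * t - \<gamma> * b) * U t t 1)
     + (- 1 - p - q) * L t 1"
  have DN: "(?N has_real_derivative ?N') (at t)"
    by (rule derivative_eq_intros refl DERIV_L assms)+ (simp add: algebra_simps)
  have D: "((\<lambda>s. - ?N s / (p * (a - b) * (a - s))) has_real_derivative
      (- ?N' * (p * (a - b) * (a - t)) + - ?N t * (p * (a - b))) / (p * (a - b) * (a - t))\<^sup>2) (at t)"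
  proof (rule DERIV_cong[OF DERIV_divide[OF DERIV_minus[OF DN]]])
    show "((\<lambda>s. p * (a - b) * (a - s)) has_real_derivative - (p * (a - b))) (at t)"
      by (auto intro!: derivative_eq_intros)
  qed (use p in \<open>simp_all add: power2_eq_square\<close>)
  \<comment> \<open>\<open>pearson\<close> for x - b: the one further relation, among L 1, U_a 1 and
    U_t 1, that clears the moments from the derivative.\<close>
  have A: "(1 + p + q + \<gamma>) * L t 1 + p * (a - b) * U t a 1 + \<gamma> * (t - b) * U t t 1 = 0"
  proof -
    have "U t c [:-b, 1:] = L t 1 + (c - b) * U t c 1" if "c \<in> {0, 1, t}" for c
    proof -
      have "[:-b, 1:] = [:-c, 1:] * 1 + smult (c - b) 1" by (simp add: one_pCons)
      then have "U t c [:-b, 1:] = U t c ([:-c, 1:] * 1 + smult (c - b) 1)" by simp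
      then show ?thesis by (simp only: U_add[OF assms(1,2) that] U_smult U_mult_linear[OF that])
    qed
    from this[of a] this[of b] this[of t]
    have "U t a [:-b, 1:] = L t 1 + (a - b) * U t a 1" "U t t [:-b, 1:] = L t 1 + (t - b) * U t t 1"
      "U t b [:-b, 1:] = L t 1"
      using assms(3) by auto
    moreover have "pderiv [:-b, 1:] = 1" by (simp add: pderiv_pCons one_pCons)
    ultimately have "L t 1 + p * (L t 1 + (a - b) * U t a 1) + q * L t 1 + \<gamma> * (L t 1 + (t - b) * U t t 1) = 0"
      using P[OF assms(1,2), of "[:-b, 1:]"] by simp
    then show ?thesis by algebra
  qed
  have Nt: "?N t = - (p * (a - b) * (a - t)) * U t a 1"
    using eqK[OF assms(1,2)] by algebra
  have n: "?N' * (a - t) - (p * (a - b) * (a - t)) * U t a 1 = (\<gamma> * p * (a - b) * (a - t)) * (U t a 1 - U t t 1)"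
    using A Nt unfolding Utx by algebra
  have e: "(- ?N' * (p * (a - b) * (a - t)) + - ?N t * (p * (a - b))) / (p * (a - b) * (a - t))\<^sup>2
     = - \<gamma> * (U t a 1 - U t t 1) / (a - t)"
  proof -
    have aux: "(- n * (k * d) + (k * d) * u * k) / (k * d)\<^sup>2 = - \<gamma> * v / d"
      if "k \<noteq> 0" "d \<noteq> 0" "n * d - (k * d) * u = \<gamma> * k * d * v" for k d n u v :: real
    proof -
      have "- n * (k * d) + (k * d) * u * k = - k * (n * d - (k * d) * u)" by (simp add: algebra_simps)
      also have "\<dots> = - k * (\<gamma> * k * d * v)" by (simp only: that(3))
      finally have *: "- n * (k * d) + (k * d) * u * k = - k * (\<gamma> * k * d * v)" .
      show ?thesis unfolding * using that(1,2) by (simp add: divide_simps power2_eq_square)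
    qed
    have "- ?N t = p * (a - b) * (a - t) * U t a 1" unfolding Nt by simp
    then show ?thesis
      using aux[of "p * (a - b)" "a - t" ?N' "U t a 1" "U t a 1 - U t t 1"] p n by simp
  qed
  have "eventually (\<lambda>s. s \<in> {0<..<1}) (nhds t)" using assms by (intro eventually_nhds_in_open) auto
  then have ev: "eventually (\<lambda>s. - ?N s / (p * (a - b) * (a - s)) = U s a 1) (nhds t)"
  proof eventually_elim
    case (elim s)
    then show ?case using eqN[of s] by (simp only: greaterThanLessThan_iff)
  qed
  show ?thesis
    using D unfolding e by (rule DERIV_cong_ev[OF refl ev refl, THEN iffD1])
qed

text \<open>By \<open>U_split\<close>, f enters through its value at a, handled by
  \<open>DERIV_U_1\<close>, and through the quotient by x - a, handled by
  \<open>DERIV_L\<close>.\<close>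

lemma DERIV_U:
  assumes "0 < t" "t < 1" "a \<in> {0, 1}"
  shows "((\<lambda>t. U t a f) has_real_derivative - \<gamma> * (U t a f - U t t f) / (a - t)) (at t)"
proof -
  let ?g = "synthetic_div f a"
  have at: "a - t \<noteq> 0" using assms by auto
  have D1: "((\<lambda>t. U t a 1) has_real_derivative - \<gamma> * (U t a 1 - U t t 1) / (a - t)) (at t)"
    using DERIV_U_1[OF assms(1,2), of 0 1 \<alpha> \<beta>] DERIV_U_1[OF assms(1,2), of 1 0 \<beta> \<alpha>] assms(3) by auto
  have D: "((\<lambda>t. poly f a * U t a 1 + L t ?g) has_real_derivative
      poly f a * (- \<gamma> * (U t a 1 - U t t 1) / (a - t)) + - \<gamma> * U t t ?g) (at t)"
    by (intro DERIV_add DERIV_cmult D1 DERIV_L assms)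
  have "f = [:-t, 1:] * ?g + smult (t - a) ?g + smult (poly f a) 1"
  proof -
    have "poly f x = (x - a) * poly ?g x + poly f a" for x
      using arg_cong[OF synthetic_div_correct'[of a f], of "\<lambda>q. poly q x"] by (simp add: algebra_simps)
    then show ?thesis
      by (simp add: poly_eq_poly_eq_iff[symmetric] fun_eq_iff algebra_simps)
  qed
  then have "U t t f = U t t ([:-t, 1:] * ?g + smult (t - a) ?g + smult (poly f a) 1)" by simp
  then have Ut: "U t t f = L t ?g + (t - a) * U t t ?g + poly f a * U t t 1"
    using assms by (simp only: U_add U_smult U_mult_linear insert_iff simp_thms)
  have Ua: "U t a f = poly f a * U t a 1 + L t ?g"
    using assms by (intro U_split) auto
  have e: "poly f a * (- \<gamma> * (U t a 1 - U t t 1) / (a - t)) + - \<gamma> * U t t ?g = - \<gamma> * (U t a f - U t t f) / (a - t)"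
    unfolding Ut Ua using at by (simp add: field_simps)
  have "eventually (\<lambda>s. s \<in> {0<..<1}) (nhds t)" using assms by (intro eventually_nhds_in_open) auto
  then have ev: "eventually (\<lambda>s. poly f a * U s a 1 + L s ?g = U s a f) (nhds t)"
  proof eventually_elim
    case (elim s)
    then show ?case using U_split[of s a f] assms(3) by auto
  qed
  show ?thesis
    using D unfolding e by (rule DERIV_cong_ev[OF refl ev refl, THEN iffD1])
qed

section \<open>Orthogonal polynomials and the Schlesinger equations\<close>

lemma DERIV_L_poly:
  assumes "0 < t" "t < 1" "poly_deriv_at N p p' t"
  shows "((\<lambda>s. L s (p s)) has_real_derivative L t p' - \<gamma> * U t t (p t)) (at t)"
proof -
  have "((\<lambda>s. L s (p s)) has_real_derivative L t p' + - \<gamma> * U t t (p t)) (at t)"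
    by (rule DERIV_functional_poly[OF assms(3), where S = "{0<..<1}"])
      (use assms in \<open>auto simp: L_add L_smult U_add U_smult algebra_simps intro: DERIV_L[simplified]\<close>)
  then show ?thesis by simp
qed

lemma DERIV_U_poly:
  assumes "0 < t" "t < 1" "a \<in> {0, 1}" "poly_deriv_at N p p' t"
  shows "((\<lambda>s. U s a (p s)) has_real_derivative
    U t a p' - \<gamma> * (U t a (p t) - U t t (p t)) / (a - t)) (at t)"
proof -
  have "((\<lambda>s. U s a (p s)) has_real_derivative
    U t a p' + (- \<gamma> * (U t a (p t) - U t t (p t)) / (a - t))) (at t)"
  proof (rule DERIV_functional_poly[OF assms(4), where S = "{0<..<1}"])
    show "((\<lambda>s. U s a f) has_real_derivative - \<gamma> * (U t a f - U t t f) / (a - t)) (at t)" for f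
      by (rule DERIV_U[OF assms(1-3)])
  qed (use assms in \<open>auto simp: U_add U_smult diff_divide_distrib add_divide_distrib right_diff_distrib distrib_left mult_ac\<close>)
  then show ?thesis by simp
qed

text \<open>Gram-Schmidt applied to the monomials. Unlike the description operator in \<open>monic_OP\<close>, this
  exhibits the coefficients as differentiable functions of \<open>t\<close>.\<close>

function gs :: "real \<Rightarrow> nat \<Rightarrow> real poly" where
  "gs t n = monom 1 n - (\<Sum>j<n. smult (L t (monom 1 n * gs t j) / L t (gs t j * gs t j)) (gs t j))"
  by auto
termination by (relation "Wellfounded.measure snd") auto

declare gs.simps [simp del]

lemma L_0 [simp]: "L t 0 = 0"
  by (simp add: L_def)

lemma L_sum: "L t (\<Sum>k\<in>S. g k) = (\<Sum>k\<in>S. L t (g k))"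
  by (induction S rule: infinite_finite_induct) (simp_all add: L_add)

lemma L_diff: "L t (f - g) = L t f - L t g"
  using L_add[of t "f - g" g] by simp

lemma degree_gs: "degree (gs t n) = n" and coeff_gs: "coeff (gs t n) n = 1"
proof -
  have "degree (gs t n) = n \<and> coeff (gs t n) n = 1"
  proof (induction n rule: less_induct)
    case (less n)
    let ?R = "\<Sum>j<n. smult (L t (monom 1 n * gs t j) / L t (gs t j * gs t j)) (gs t j)"
    have c: "coeff ?R k = 0" if "k \<ge> n" for k
      using less that by (auto simp: coeff_sum intro!: sum.neutral coeff_eq_0)
    have "coeff (gs t n) n = 1" by (subst gs.simps) (simp add: c)
    moreover have "degree (gs t n) \<le> n"
      by (rule degree_le) (subst gs.simps, simp add: c)
    ultimately show ?case using le_degree[of "gs t n" n] by simp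
  qed
  then show "degree (gs t n) = n" "coeff (gs t n) n = 1" by auto
qed

lemma gs_nonzero [simp]: "gs t n \<noteq> 0"
  using coeff_gs[of t n] by auto

lemma gs_orth_less:
  assumes "0 < t" "t < 1"
  shows "i < n \<Longrightarrow> L t (gs t n * gs t i) = 0"
proof (induction n arbitrary: i rule: less_induct)
  case (less n)
  have "L t (gs t i * gs t i) \<noteq> 0"
    using L_pos[OF assms, of "gs t i"] by simp
  let ?c = "\<lambda>j. L t (monom 1 n * gs t j) / L t (gs t j * gs t j)"
  have "L t (gs t n * gs t i) = L t (monom 1 n * gs t i - (\<Sum>j<n. smult (?c j) (gs t j * gs t i)))"
    by (subst gs.simps) (simp add: left_diff_distrib sum_distrib_right)
  also have "\<dots> = L t (monom 1 n * gs t i) - (\<Sum>j<n. ?c j * L t (gs t j * gs t i))"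
    by (simp add: L_diff L_sum L_smult)
  also have "(\<Sum>j<n. ?c j * L t (gs t j * gs t i)) = (\<Sum>j<n. if j = i then L t (monom 1 n * gs t i) else 0)"
  proof (rule sum.cong)
    fix j assume "j \<in> {..<n}"
    then have "j \<noteq> i \<Longrightarrow> L t (gs t j * gs t i) = 0"
      using less.IH[of j i] less.IH[of i j] less.prems by (cases "j < i") (auto simp: mult.commute)
    then show "?c j * L t (gs t j * gs t i) = (if j = i then L t (monom 1 n * gs t i) else 0)"
      using L_pos[OF assms, of "gs t i"] by auto
  qed simp
  also have "\<dots> = L t (monom 1 n * gs t i)" using less.prems by simp
  finally show ?case by simp
qed

text \<open>The alternative f = 0 is listed because the zero polynomial has degree 0, which is not
  below n when n = 0; vanishing derivatives and quotients thereby need no special treatment.\<close>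

lemma gs_orth:
  assumes "0 < t" "t < 1" "f = 0 \<or> degree f < n"
  shows "L t (gs t n * f) = 0"
proof -
  have "m \<le> n \<Longrightarrow> f = 0 \<or> degree f < m \<Longrightarrow> L t (gs t n * f) = 0" for m
  proof (induction m arbitrary: f)
    case (Suc m)
    let ?g = "f - smult (coeff f m) (gs t m)"
    have "coeff ?g k = 0" if "k \<ge> m" for k
      using that Suc.prems degree_gs[of t m] coeff_gs[of t m]
      by (cases "k = m") (auto intro!: coeff_eq_0 simp: coeff_eq_0)
    then have "?g = 0 \<or> degree ?g < m"
      by (metis leading_coeff_0_iff not_le)
    then have "L t (gs t n * ?g) = 0" using Suc by simp
    moreover have "L t (gs t n * gs t m) = 0" using gs_orth_less assms Suc.prems by simp
    moreover have "gs t n * f = gs t n * ?g + smult (coeff f m) (gs t n * gs t m)"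
      by (simp add: algebra_simps)
    ultimately show ?case by (simp only: L_add L_smult mult_zero_right add_0)
  qed auto
  with assms show ?thesis by blast
qed

text \<open>Two candidates differ by a polynomial of degree below n, which is orthogonal to itself
  and so is 0 by \<open>L_pos\<close>.\<close>

lemma monic_OP_eq:
  assumes "0 < t" "t < 1"
  shows "monic_OP \<alpha> \<beta> \<gamma> A B n t = gs t n"
  unfolding monic_OP_def
proof (rule the_equality)
  have L: "integral {0..1} (\<lambda>x. poly p x * poly q x * w x t) = L t (p * q)" for p q
    by (simp add: L_def)
  show "degree (gs t n) = n \<and> lead_coeff (gs t n) = 1 \<and>
    (\<forall>q. degree q < n \<longrightarrow> integral {0..1} (\<lambda>x. poly (gs t n) x * poly q x * w x t) = 0)"
    unfolding L using degree_gs coeff_gs gs_orth assms by simp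
  fix p assume p: "degree p = n \<and> lead_coeff p = 1 \<and>
    (\<forall>q. degree q < n \<longrightarrow> integral {0..1} (\<lambda>x. poly p x * poly q x * w x t) = 0)"
  let ?d = "p - gs t n"
  show "p = gs t n"
  proof (cases "?d = 0")
    case False
    have "coeff ?d k = 0" if "k \<ge> n" for k
      using that p degree_gs[of t n] coeff_gs[of t n]
      by (cases "k = n") (auto simp: coeff_eq_0)
    with False have d: "degree ?d < n" by (metis leading_coeff_0_iff not_le)
    have "L t (?d * ?d) = L t (p * ?d) - L t (gs t n * ?d)"
      by (simp add: left_diff_distrib L_diff)
    also have "\<dots> = 0" using p d gs_orth[OF assms, of ?d n] unfolding L by simp
    finally show ?thesis using L_pos[OF assms False] by simp
  qed simp
qed

text \<open>Only existence is drawn from the Gram-Schmidt recursion, whose denominators are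
  positive; the derivative itself is identified afterwards through orthogonality.\<close>

lemma gs_poly_deriv:
  assumes "0 < t" "t < 1"
  shows "\<exists>p'. poly_deriv_at n (\<lambda>s. gs s n) p' t"
proof (induction n rule: less_induct)
  case (less n)
  then obtain p' where p': "\<And>j. j < n \<Longrightarrow> poly_deriv_at j (\<lambda>s. gs s j) (p' j) t" by metis
  have ex: "\<exists>r. poly_deriv_at n (\<lambda>s. smult (L s (monom 1 n * gs s j) / L s (gs s j * gs s j)) (gs s j)) r t"
    if j: "j < n" for j
  proof -
    have "poly_deriv_at (n + j) (\<lambda>s. monom 1 n * gs s j) (0 * gs t j + monom 1 n * p' j) t"
      by (intro poly_deriv_at_mult poly_deriv_at_const p' j) (simp add: degree_monom_eq)
    note D1 = DERIV_L_poly[OF assms this]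
    note D2 = DERIV_L_poly[OF assms poly_deriv_at_mult[OF p'[OF j] p'[OF j]]]
    have nz: "L t (gs t j * gs t j) \<noteq> 0" using L_pos[OF assms, of "gs t j"] by simp
    from poly_deriv_at_smult[OF p'[OF j] less_imp_le[OF j] DERIV_divide[OF D1 D2 nz]]
    show ?thesis by blast
  qed
  let ?f = "\<lambda>j s. smult (L s (monom 1 n * gs s j) / L s (gs s j * gs s j)) (gs s j)"
  from ex have "\<forall>j\<in>{..<n}. \<exists>r. poly_deriv_at n (?f j) r t" by simp
  from bchoice[OF this] obtain r where r: "\<forall>j\<in>{..<n}. poly_deriv_at n (?f j) (r j) t" ..
  have "poly_deriv_at n (\<lambda>s. monom 1 n - (\<Sum>j<n. ?f j s)) (0 - (\<Sum>j<n. r j)) t"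
  proof (intro poly_deriv_at_diff poly_deriv_at_sum poly_deriv_at_const)
    show "poly_deriv_at n (?f j) (r j) t" if "j \<in> {..<n}" for j using r that by (rule bspec)
  qed (simp add: degree_monom_eq)
  then have "poly_deriv_at n (\<lambda>s. gs s n) (0 - (\<Sum>j<n. r j)) t"
    by (simp only: gs.simps[of _ n])
  then show ?case ..
qed

text \<open>The entries of the residue matrix at \<open>a\<close> in the linear differential equation for
  \<open>(P\<^sub>n, P\<^sub>n\<^sub>+\<^sub>1)\<close>; \<open>p\<close> is the exponent \<open>\<alpha>\<close>, \<open>\<beta>\<close> or \<open>\<gamma>\<close> of the weight at \<open>a\<close>.\<close>

definition X :: "nat \<Rightarrow> real \<Rightarrow> real \<Rightarrow> real \<Rightarrow> real" where
  "X n p a t = p * U t a (gs t n * gs t n) / L t (gs t n * gs t n)"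

definition V :: "nat \<Rightarrow> real \<Rightarrow> real \<Rightarrow> real \<Rightarrow> real" where
  "V n p a t = p * U t a (gs t n * gs t (Suc n)) / L t (gs t n * gs t n)"

definition Z :: "nat \<Rightarrow> real \<Rightarrow> real \<Rightarrow> real \<Rightarrow> real" where
  "Z n p a t = p * U t a (gs t (Suc n) * gs t (Suc n)) / L t (gs t n * gs t n)"

section \<open>Consequences of orthogonality and the sum relations for X and V\<close>

lemma L_gs_top:
  assumes "0 < t" "t < 1" "degree f \<le> n"
  shows "L t (gs t n * f) = coeff f n * L t (gs t n * gs t n)"
proof -
  let ?g = "f - smult (coeff f n) (gs t n)"
  have "coeff ?g k = 0" if "k \<ge> n" for k
    using that assms degree_gs[of t n] coeff_gs[of t n] by (cases "k = n") (auto simp: coeff_eq_0)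
  then have "?g = 0 \<or> degree ?g < n" by (metis leading_coeff_0_iff not_le)
  then have "L t (gs t n * ?g) = 0" using gs_orth assms by blast
  then show ?thesis by (simp add: right_diff_distrib L_diff L_smult)
qed

text \<open>The quotient (f - f(a)) / (x - a) is 0 or of degree below n, hence orthogonal to
  P_n.\<close>

lemma U_gs_eval:
  assumes "0 < t" "t < 1" "a \<in> {0, 1, t}" "degree f \<le> n"
  shows "U t a (gs t n * f) = poly f a * U t a (gs t n)"
proof -
  let ?g = "synthetic_div f a"
  have "?g = 0 \<or> degree ?g < n"
    using assms(4) synthetic_div_eq_0_iff[of f a] by (cases "degree f = 0") (auto simp: degree_synthetic_div)
  then have L: "L t (gs t n * ?g) = 0" using gs_orth assms by blast
  have "gs t n * f = [:-a, 1:] * (gs t n * ?g) + smult (poly f a) (gs t n)"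
    by (subst synthetic_div_correct'[of a f, symmetric]) (simp add: algebra_simps)
  then have "U t a (gs t n * f) = U t a ([:-a, 1:] * (gs t n * ?g) + smult (poly f a) (gs t n))" by simp
  then show ?thesis
    by (simp only: U_add[OF assms(1-3)] U_smult U_mult_linear[OF assms(3)] L add_0)
qed

text \<open>One degree beyond \<open>U_gs_eval\<close>: the quotient of P_(n+1) by x - a is monic of
  degree n and contributes h_n. This is the source of the shift by \<open>p\<close> in the
  determinant relation.\<close>

lemma U_gs_Suc:
  assumes "0 < t" "t < 1" "a \<in> {0, 1, t}"
  shows "U t a (gs t n * gs t (Suc n)) = L t (gs t n * gs t n) + poly (gs t (Suc n)) a * U t a (gs t n)"
proof -
  let ?f = "gs t (Suc n)"
  let ?g = "synthetic_div ?f a"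
  have d: "degree ?g = n" by (simp add: degree_synthetic_div degree_gs)
  have f: "?f = [:-a, 1:] * ?g + [:poly ?f a:]"
    using synthetic_div_correct'[of a ?f] by simp
  have "coeff ?f (Suc n) = coeff ([:-a, 1:] * ?g + [:poly ?f a:]) (Suc n)"
    using f by simp
  also have "\<dots> = coeff ?g n" using d by (simp add: coeff_eq_0)
  finally have c: "coeff ?g n = 1" by (simp add: coeff_gs)
  have "gs t n * ?f = [:-a, 1:] * (gs t n * ?g) + smult (poly ?f a) (gs t n)"
    by (subst f) (simp add: algebra_simps)
  then have "U t a (gs t n * ?f) = U t a ([:-a, 1:] * (gs t n * ?g) + smult (poly ?f a) (gs t n))" by simp
  then show ?thesis
    using L_gs_top[OF assms(1,2), of ?g n] d c
    by (simp add: U_add[OF assms] U_smult U_mult_linear[OF assms(3)] del: mult_pCons_left)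
qed

lemma L_gs_pderiv:
  assumes "0 < t" "t < 1"
  shows "L t (gs t n * pderiv (gs t n)) = 0"
  by (rule gs_orth[OF assms]) (cases "n = 0", auto simp: pderiv_eq_0_iff degree_gs degree_pderiv)

lemma h_pos: "0 < t \<Longrightarrow> t < 1 \<Longrightarrow> L t (gs t n * gs t n) > 0"
  using L_pos gs_nonzero by blast

lemma X_sum:
  assumes "0 < t" "t < 1"
  shows "X n \<alpha> 0 t + X n \<beta> 1 t + X n \<gamma> t t = 0"
proof -
  have "L t (pderiv (gs t n * gs t n)) = 0"
    using L_gs_pderiv[OF assms, of n] by (simp only: pderiv_mult L_add add_0)
  then have *: "\<alpha> * U t 0 (gs t n * gs t n) + \<beta> * U t 1 (gs t n * gs t n) + \<gamma> * U t t (gs t n * gs t n) = 0"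
    using pearson[OF assms, of "gs t n * gs t n"] by simp
  show "X n \<alpha> 0 t + X n \<beta> 1 t + X n \<gamma> t t = 0"
    using * by (simp only: X_def add_divide_distrib[symmetric] div_0)
qed

text \<open>\<open>pearson\<close> for x P^2. Its derivative is P (P + 2 x P'), whose second factor
  has leading coefficient 2n + 1; each of the three poles adds its exponent times h_n.\<close>

lemma X_sum_weighted:
  assumes "0 < t" "t < 1"
  shows "X n \<beta> 1 t + t * X n \<gamma> t t = - (2 * real n + 1 + \<alpha> + \<beta> + \<gamma>)"
proof -
  let ?P = "gs t n" let ?h = "L t (?P * ?P)"
  let ?d = "?P + smult 2 ([:0, 1:] * pderiv ?P)"
  have "pderiv ([:0, 1:] * (?P * ?P)) = ?P * ?d"
    by (simp only: poly_eq_poly_eq_iff[symmetric] fun_eq_iff pderiv_mult poly_add poly_mult poly_smult)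
      (simp add: pderiv_pCons algebra_simps)
  moreover have "degree ?d \<le> n"
    by (intro degree_add_le) (auto simp: degree_gs degree_pderiv pderiv_eq_0_iff intro: order_trans[OF degree_pCons_le])
  moreover have "coeff ?d n = 1 + 2 * real n"
    by (cases n) (simp_all add: coeff_gs coeff_pderiv del: of_nat_Suc)
  ultimately have L: "L t (pderiv ([:0, 1:] * (?P * ?P))) = (1 + 2 * real n) * ?h"
    using L_gs_top[OF assms, of ?d n] by simp
  have U: "U t a ([:0, 1:] * (?P * ?P)) = ?h + a * U t a (?P * ?P)" if "a \<in> {0, 1, t}" for a
  proof -
    have "[:0, 1:] * (?P * ?P) = [:-a, 1:] * (?P * ?P) + smult a (?P * ?P)" by simp
    then have "U t a ([:0, 1:] * (?P * ?P)) = U t a ([:-a, 1:] * (?P * ?P) + smult a (?P * ?P))" by simp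
    then show ?thesis by (simp only: U_add[OF assms that] U_smult U_mult_linear[OF that])
  qed
  have "(1 + 2 * real n) * ?h + \<alpha> * ?h + \<beta> * (?h + U t 1 (?P * ?P)) + \<gamma> * (?h + t * U t t (?P * ?P)) = 0"
    using pearson[OF assms, of "[:0, 1:] * (?P * ?P)"] U[of 0] U[of 1] U[of t] L by simp
  then have "\<beta> * U t 1 (?P * ?P) + t * (\<gamma> * U t t (?P * ?P)) = - (2 * real n + 1 + \<alpha> + \<beta> + \<gamma>) * ?h"
    by algebra
  then have "(\<beta> * U t 1 (?P * ?P) + t * (\<gamma> * U t t (?P * ?P))) / ?h = - (2 * real n + 1 + \<alpha> + \<beta> + \<gamma>)"
    using h_pos[OF assms, of n] by (simp only: nonzero_mult_div_cancel_right)
  then show ?thesis by (simp add: X_def add_divide_distrib)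
qed

text \<open>\<open>pearson\<close> for P Q: Q is orthogonal to P', and Q' has leading coefficient n
  + 1.\<close>

lemma V_sum:
  assumes "0 < t" "t < 1"
  shows "V n \<alpha> 0 t + V n \<beta> 1 t + V n \<gamma> t t = - (real n + 1)"
proof -
  let ?P = "gs t n" let ?Q = "gs t (Suc n)" let ?h = "L t (?P * ?P)"
  have "L t (?Q * pderiv ?P) = 0"
    by (rule gs_orth[OF assms]) (auto simp: degree_gs degree_pderiv)
  moreover have "L t (?P * pderiv ?Q) = (real n + 1) * ?h"
    using L_gs_top[OF assms, of "pderiv ?Q" n] by (simp add: degree_pderiv degree_gs coeff_pderiv coeff_gs add.commute)
  ultimately have "L t (pderiv (?P * ?Q)) = (real n + 1) * ?h"
    by (simp add: pderiv_mult L_add)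
  then have "\<alpha> * U t 0 (?P * ?Q) + \<beta> * U t 1 (?P * ?Q) + \<gamma> * U t t (?P * ?Q) = - (real n + 1) * ?h"
    using pearson[OF assms, of "?P * ?Q"] by (simp add: algebra_simps)
  then have "(\<alpha> * U t 0 (?P * ?Q) + \<beta> * U t 1 (?P * ?Q) + \<gamma> * U t t (?P * ?Q)) / ?h = - (real n + 1)"
    using h_pos[OF assms, of n] by (simp only: nonzero_mult_div_cancel_right)
  then show ?thesis by (simp add: V_def add_divide_distrib)
qed

text \<open>The determinant of the residue matrix vanishes.\<close>

lemma XZ_eq:
  assumes "0 < t" "t < 1" "a \<in> {0, 1, t}"
  shows "X n p a t * Z n p a t = V n p a t * (V n p a t - p)"
proof -
  let ?P = "gs t n" let ?Q = "gs t (Suc n)" let ?h = "L t (?P * ?P)"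
  have "U t a (?P * ?P) = poly ?P a * U t a ?P"
    by (rule U_gs_eval[OF assms]) (simp add: degree_gs)
  moreover have "U t a (?Q * ?Q) = poly ?Q a * U t a ?Q" "U t a (?Q * ?P) = poly ?P a * U t a ?Q"
    by (rule U_gs_eval[OF assms], simp add: degree_gs)+
  ultimately have xq: "U t a (?P * ?P) * U t a (?Q * ?Q) = U t a (?P * ?Q) * (U t a (?P * ?Q) - ?h)"
    using U_gs_Suc[OF assms, of n] by (simp add: mult.commute[of ?Q ?P]) algebra
  have "X n p a t * Z n p a t = p * p * (U t a (?P * ?P) * U t a (?Q * ?Q)) / (?h * ?h)"
    by (simp add: X_def Z_def)
  also have "\<dots> = V n p a t * (V n p a t - p)"
    unfolding xq V_def using h_pos[OF assms(1,2), of n] by (simp add: divide_simps) (simp add: algebra_simps)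
  finally show ?thesis .
qed

section \<open>The t-derivatives of P_n and P_(n+1)\<close>

text \<open>\<open>D\<close> is c times the reproducing kernel at t for degree at most n. The
  difference of the two sides has degree at most n and is orthogonal to all such polynomials, hence
  to itself.\<close>

lemma christoffel_darboux:
  assumes "0 < t" "t < 1" "degree D \<le> n"
    and repr: "\<And>f. degree f \<le> n \<Longrightarrow> L t (D * f) = c * poly f t"
  shows "[:-t, 1:] * D = smult (c / L t (gs t n * gs t n))
    (smult (poly (gs t n) t) (gs t (Suc n)) - smult (poly (gs t (Suc n)) t) (gs t n))"
proof -
  let ?P = "gs t n" let ?Q = "gs t (Suc n)" let ?h = "L t (?P * ?P)"
  let ?R = "smult (c / ?h) (smult (poly ?P t) ?Q - smult (poly ?Q t) ?P)"
  let ?G = "[:-t, 1:] * D - ?R"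
  have h: "?h > 0" using h_pos assms by blast
  have cD: "coeff D n * ?h = c * poly ?P t"
    using L_gs_top[OF assms(1,2,3)] repr[of ?P] by (simp add: degree_gs mult.commute)
  have "coeff ?G k = 0" if kn: "k > n" for k
  proof (cases "k = Suc n")
    case True
    have "coeff ([:-t, 1:] * D) k = coeff D n"
      using True assms(3) by (simp add: coeff_eq_0)
    moreover have "coeff ?R k = c / ?h * poly ?P t"
      using True by (simp add: coeff_gs coeff_eq_0 degree_gs)
    ultimately show ?thesis using cD h by (simp add: field_simps)
  next
    case False
    with kn have k: "k > Suc n" by auto
    then obtain j where "k = Suc j" "j > n" by (metis Suc_lessE)
    then show ?thesis using k assms(3) by (simp add: coeff_eq_0 degree_gs)
  qed
  then have dG: "degree ?G \<le> n" by (intro degree_le) auto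
  have "L t (?G * f) = 0" if f: "degree f \<le> n" for f
  proof -
    \<comment> \<open>Removing the multiple of P_(n+1) from (x - t) f brings the degree down to n,
      where the reproducing property applies; P_(n+1) is orthogonal to \<open>D\<close>, and r(t)
      retains only that multiple.\<close>
    define r where "r = [:-t, 1:] * f - smult (coeff f n) ?Q"
    have "coeff r k = 0" if kn: "k > n" for k
    proof -
      obtain j where "k = Suc j" "j \<ge> n" using kn by (cases k) auto
      then show ?thesis using f by (cases "j = n") (simp_all add: r_def coeff_eq_0 degree_gs coeff_gs)
    qed
    then have dr: "degree r \<le> n" by (intro degree_le) auto
    have DQ: "L t (?Q * D) = 0" by (rule gs_orth[OF assms(1,2)]) (use assms(3) in auto)
    have "[:-t, 1:] * D * f = D * r + smult (coeff f n) (?Q * D)"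
      by (simp add: r_def algebra_simps)
    then have "L t ([:-t, 1:] * D * f) = L t (D * r + smult (coeff f n) (?Q * D))" by simp
    also have "\<dots> = c * poly r t" using repr[OF dr] by (simp only: L_add L_smult DQ mult_zero_right add_0_right)
    also have "\<dots> = - c * coeff f n * poly ?Q t" by (simp add: r_def)
    finally have 1: "L t ([:-t, 1:] * D * f) = - c * coeff f n * poly ?Q t" .
    have Qf: "L t (?Q * f) = 0" by (rule gs_orth[OF assms(1,2)]) (use f in auto)
    have "?R * f = smult (c / ?h * poly ?P t) (?Q * f) + smult (- (c / ?h * poly ?Q t)) (?P * f)"
      by (simp add: smult_diff_right algebra_simps)
    then have "L t (?R * f) = L t (smult (c / ?h * poly ?P t) (?Q * f) + smult (- (c / ?h * poly ?Q t)) (?P * f))"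
      by simp
    also have "\<dots> = - (c / ?h * poly ?Q t) * (coeff f n * ?h)"
      by (simp only: L_add L_smult Qf L_gs_top[OF assms(1,2) f] mult_zero_right add_0)
    also have "\<dots> = - c * coeff f n * poly ?Q t" using h by simp
    finally have 2: "L t (?R * f) = - c * coeff f n * poly ?Q t" .
    show ?thesis by (simp only: left_diff_distrib[of _ _ f] L_diff 1 2 diff_self)
  qed
  from this[OF dG] have "?G = 0"
    using L_pos[OF assms(1,2), of ?G] by (metis less_irrefl)
  then show ?thesis by simp
qed

text \<open>Being monic, P_n has a derivative of lower degree; differentiating L (P_n f) = 0 shows
  that this derivative acts as a multiple of evaluation at t.\<close>

lemma gs_deriv_repr:
  assumes "0 < t" "t < 1" "poly_deriv_at n (\<lambda>s. gs s n) p' t"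
  shows "p' = 0 \<or> degree p' < n"
    and "f = 0 \<or> degree f < n \<Longrightarrow> L t (p' * f) = \<gamma> * poly f t * U t t (gs t n)"
proof -
  have "((\<lambda>s. coeff (gs s n) n) has_real_derivative coeff p' n) (at t)"
    using assms(3) by (simp add: poly_deriv_at_def)
  then have "coeff p' n = 0" using DERIV_unique[OF _ DERIV_const[of 1]] by (simp add: coeff_gs)
  then have "coeff p' k = 0" if "k \<ge> n" for k
    using that poly_deriv_at_degree[OF assms(3)] by (cases "k = n") (auto simp: coeff_eq_0)
  then show "p' = 0 \<or> degree p' < n" by (metis leading_coeff_0_iff not_le)
  assume f: "f = 0 \<or> degree f < n"
  have "poly_deriv_at (n + degree f) (\<lambda>s. gs s n * f) (p' * f + gs t n * 0) t"
    by (intro poly_deriv_at_mult assms poly_deriv_at_const) simp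
  from DERIV_L_poly[OF assms(1,2) this]
  have D: "((\<lambda>s. L s (gs s n * f)) has_real_derivative L t (p' * f) - \<gamma> * U t t (gs t n * f)) (at t)"
    by simp
  have "eventually (\<lambda>s. s \<in> {0<..<1}) (nhds t)" using assms by (intro eventually_nhds_in_open) auto
  then have ev: "eventually (\<lambda>s. L s (gs s n * f) = 0) (nhds t)"
    by eventually_elim (use gs_orth f in auto)
  have "((\<lambda>s. 0) has_real_derivative L t (p' * f) - \<gamma> * U t t (gs t n * f)) (at t)"
    using D by (rule DERIV_cong_ev[OF refl ev refl, THEN iffD1])
  from DERIV_unique[OF this DERIV_const]
  have "L t (p' * f) = \<gamma> * U t t (gs t n * f)" by simp
  moreover have "U t t (gs t n * f) = poly f t * U t t (gs t n)"
    by (rule U_gs_eval) (use assms f in auto)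
  ultimately show "L t (p' * f) = \<gamma> * poly f t * U t t (gs t n)" by simp
qed

lemma deform_Q:
  assumes "0 < t" "t < 1" "poly_deriv_at (Suc n) (\<lambda>s. gs s (Suc n)) q' t"
  defines "h \<equiv> L t (gs t n * gs t n)"
  shows "[:-t, 1:] * q' = smult (\<gamma> * U t t (gs t n * gs t (Suc n)) / h) (gs t (Suc n))
    - smult (\<gamma> * U t t (gs t (Suc n) * gs t (Suc n)) / h) (gs t n)"
proof -
  let ?P = "gs t n" let ?Q = "gs t (Suc n)"
  have "degree q' \<le> n" using gs_deriv_repr(1)[OF assms(1-3)] by auto
  moreover have "L t (q' * f) = (\<gamma> * U t t ?Q) * poly f t" if "degree f \<le> n" for f
    using gs_deriv_repr(2)[OF assms(1-3), of f] that by simp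
  ultimately have "[:-t, 1:] * q' = smult (\<gamma> * U t t ?Q / h) (smult (poly ?P t) ?Q - smult (poly ?Q t) ?P)"
    unfolding h_def by (rule christoffel_darboux[OF assms(1,2)])
  moreover have "U t t (?Q * ?P) = poly ?P t * U t t ?Q" "U t t (?Q * ?Q) = poly ?Q t * U t t ?Q"
    by (rule U_gs_eval; use assms in \<open>simp add: degree_gs\<close>)+
  ultimately show ?thesis by (simp add: smult_diff_right mult.commute[of ?Q ?P] mult_ac)
qed

text \<open>Unlike the derivative of P_(n+1), that of P_n reproduces values only below degree n. Its
  kernel lacks the top term, and supplying it produces the third summand.\<close>

lemma deform_P:
  assumes "0 < t" "t < 1" "poly_deriv_at n (\<lambda>s. gs s n) p' t"
  defines "h \<equiv> L t (gs t n * gs t n)"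
  shows "[:-t, 1:] * p' = smult (\<gamma> * U t t (gs t n * gs t n) / h) (gs t (Suc n))
    - smult (\<gamma> * (U t t (gs t n * gs t (Suc n)) - h) / h) (gs t n)
    - smult (\<gamma> * U t t (gs t n * gs t n) / h) ([:-t, 1:] * gs t n)"
proof -
  let ?P = "gs t n" let ?Q = "gs t (Suc n)"
  define c where "c = \<gamma> * U t t ?P"
  have h: "h > 0" unfolding h_def using h_pos assms(1,2) by blast
  \<comment> \<open>The added term is c P_n(t) P_n / h_n, the summand of index n of the
    kernel.\<close>
  let ?D = "p' + smult (c / h * poly ?P t) ?P"
  have dp: "degree p' \<le> n" using poly_deriv_at_degree[OF assms(3)] .
  have "degree ?D \<le> n"
    by (intro degree_add_le dp order_trans[OF degree_smult_le]) (simp add: degree_gs)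
  moreover have "L t (?D * f) = c * poly f t" if f: "degree f \<le> n" for f
  proof -
    define g where "g = f - smult (coeff f n) ?P"
    have "coeff g k = 0" if "k \<ge> n" for k
      using that f degree_gs[of t n] coeff_gs[of t n] by (cases "k = n") (auto simp: coeff_eq_0 g_def)
    then have g: "g = 0 \<or> degree g < n" by (metis leading_coeff_0_iff not_le)
    have Pp: "L t (?P * p') = 0"
      by (rule gs_orth[OF assms(1,2) gs_deriv_repr(1)[OF assms(1-3)]])
    have "p' * f = p' * g + smult (coeff f n) (?P * p')"
      by (simp add: g_def right_diff_distrib mult.commute[of p' ?P])
    then have "L t (p' * f) = L t (p' * g) + coeff f n * L t (?P * p')"
      by (simp only: L_add L_smult)
    then have "L t (p' * f) = c * poly g t"
      using gs_deriv_repr(2)[OF assms(1-3) g] Pp by (simp add: c_def)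
    moreover have "L t (?P * f) = coeff f n * h"
      unfolding h_def by (rule L_gs_top[OF assms(1,2) f])
    ultimately have "L t (?D * f) = c * poly g t + c / h * poly ?P t * (coeff f n * h)"
      by (simp add: distrib_right L_add L_smult)
    also have "\<dots> = c * poly f t" using h by (simp add: g_def algebra_simps)
    finally show ?thesis .
  qed
  ultimately have "[:-t, 1:] * ?D = smult (c / h) (smult (poly ?P t) ?Q - smult (poly ?Q t) ?P)"
    unfolding h_def by (rule christoffel_darboux[OF assms(1,2)])
  then have "[:-t, 1:] * p' = smult (c / h) (smult (poly ?P t) ?Q - smult (poly ?Q t) ?P)
    - smult (c / h * poly ?P t) ([:-t, 1:] * ?P)"
    unfolding distrib_left mult_smult_right by (simp only: eq_diff_eq)
  moreover have "U t t (?P * ?P) = poly ?P t * U t t ?P"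
    by (rule U_gs_eval) (use assms in \<open>simp_all add: degree_gs\<close>)
  then have "\<gamma> * U t t (?P * ?P) / h = c / h * poly ?P t" by (simp add: c_def)
  moreover have "U t t (?P * ?Q) - h = poly ?Q t * U t t ?P"
    using U_gs_Suc[OF assms(1,2), of t n] by (simp add: h_def)
  then have "\<gamma> * (U t t (?P * ?Q) - h) / h = c / h * poly ?Q t" by (simp add: c_def)
  ultimately show ?thesis by (simp only: smult_diff_right smult_smult)
qed

lemma U_diff:
  assumes "0 < t" "t < 1" "a \<in> {0, 1, t}"
  shows "U t a (f - g) = U t a f - U t a g"
  using U_add[OF assms, of "f - g" g] by simp

lemma U_mult_shift:
  assumes "0 < t" "t < 1" "a \<in> {0, 1, t}"
  shows "U t a ([:-t, 1:] * f) = (a - t) * U t a f + L t f"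
proof -
  have "[:-t, 1:] * f = [:-a, 1:] * f + smult (a - t) f"
    by (simp add: smult_diff_left)
  then have "U t a ([:-t, 1:] * f) = U t a ([:-a, 1:] * f + smult (a - t) f)" by (rule arg_cong)
  then show ?thesis by (simp only: U_add[OF assms] U_smult U_mult_linear[OF assms(3)] add.commute)
qed

text \<open>After multiplication by x - t, \<open>U\<close> at a and \<open>U\<close> at t both
  contain the unknown L (p' g); subtracting the two evaluations removes it and leaves (a - t) U_a
  (p' g).\<close>

lemma U_deform:
  assumes "0 < t" "t < 1" "a \<in> {0, 1}"
    and R: "[:-t, 1:] * p' = smult c1 Q - smult c2 P - smult c3 ([:-t, 1:] * P)"
  shows "U t a (p' * g) = (c1 * (U t a (Q * g) - U t t (Q * g)) - c2 * (U t a (P * g) - U t t (P * g))) / (a - t)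
    - c3 * U t a (P * g)"
proof -
  have a: "a \<in> {0, 1, t}" "t \<in> {0, 1, t}" "a - t \<noteq> 0" using assms by auto
  have Rg: "[:-t, 1:] * (p' * g) = smult c1 (Q * g) - smult c2 (P * g) - smult c3 ([:-t, 1:] * (P * g))"
    using arg_cong[OF R, of "\<lambda>f. f * g"] by (simp only: left_diff_distrib mult_smult_left mult.assoc)
  have "U t b ([:-t, 1:] * (p' * g)) =
      c1 * U t b (Q * g) - c2 * U t b (P * g) - c3 * ((b - t) * U t b (P * g) + L t (P * g))"
    if "b \<in> {0, 1, t}" for b
    unfolding Rg U_diff[OF assms(1,2) that] U_smult U_mult_shift[OF assms(1,2) that] ..
  from this[OF a(1)] this[OF a(2)]
  have "(a - t) * U t a (p' * g) = c1 * (U t a (Q * g) - U t t (Q * g)) - c2 * (U t a (P * g) - U t t (P * g))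
    - c3 * ((a - t) * U t a (P * g))"
    unfolding U_mult_shift[OF assms(1,2) a(1)] U_mult_shift[OF assms(1,2) a(2)]
    by (simp add: algebra_simps)
  then show ?thesis using a(3) by (simp add: field_simps)
qed

lemma gs_deform:
  assumes "0 < t" "t < 1"
  obtains p' q' where "poly_deriv_at n (\<lambda>s. gs s n) p' t" "poly_deriv_at (Suc n) (\<lambda>s. gs s (Suc n)) q' t"
    "\<And>a g. a \<in> {0, 1} \<Longrightarrow> U t a (p' * g) =
       (X n \<gamma> t t * (U t a (gs t (Suc n) * g) - U t t (gs t (Suc n) * g))
        - (V n \<gamma> t t - \<gamma>) * (U t a (gs t n * g) - U t t (gs t n * g))) / (a - t) - X n \<gamma> t t * U t a (gs t n * g)"
    "\<And>a g. a \<in> {0, 1} \<Longrightarrow> U t a (q' * g) =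
       (V n \<gamma> t t * (U t a (gs t (Suc n) * g) - U t t (gs t (Suc n) * g))
        - Z n \<gamma> t t * (U t a (gs t n * g) - U t t (gs t n * g))) / (a - t)"
proof -
  obtain p' where p': "poly_deriv_at n (\<lambda>s. gs s n) p' t" using gs_poly_deriv assms by blast
  obtain q' where q': "poly_deriv_at (Suc n) (\<lambda>s. gs s (Suc n)) q' t" using gs_poly_deriv assms by blast
  have h: "L t (gs t n * gs t n) \<noteq> 0" using h_pos[OF assms, of n] by simp
  have v: "\<gamma> * (U t t (gs t n * gs t (Suc n)) - L t (gs t n * gs t n)) / L t (gs t n * gs t n) = V n \<gamma> t t - \<gamma>"
    using h by (simp add: V_def right_diff_distrib diff_divide_distrib)
  note P = deform_P[OF assms p', folded X_def, unfolded v]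
  note Q = deform_Q[OF assms q', folded V_def Z_def]
  have Q': "[:-t, 1:] * q' = smult (V n \<gamma> t t) (gs t (Suc n)) - smult (Z n \<gamma> t t) (gs t n) - smult 0 ([:-t, 1:] * gs t n)"
    using Q by simp
  show ?thesis
    by (rule that[OF p' q'], erule U_deform[OF assms _ P], use U_deform[OF assms _ Q'] in simp)
qed

section \<open>The Schlesinger equations at 0 and 1\<close>

lemma DERIV_h:
  assumes "0 < t" "t < 1"
  shows "((\<lambda>s. L s (gs s n * gs s n)) has_real_derivative - X n \<gamma> t t * L t (gs t n * gs t n)) (at t)"
proof -
  obtain p' where p': "poly_deriv_at n (\<lambda>s. gs s n) p' t" using gs_poly_deriv assms by blast
  have Pp: "L t (gs t n * p') = 0"
    by (rule gs_orth[OF assms gs_deriv_repr(1)[OF assms p']])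
  have "L t (p' * gs t n + gs t n * p') = 0"
    unfolding L_add mult.commute[of p'] Pp by simp
  moreover have "\<gamma> * U t t (gs t n * gs t n) = X n \<gamma> t t * L t (gs t n * gs t n)"
    using h_pos[OF assms, of n] by (simp add: X_def)
  ultimately show ?thesis
    using DERIV_L_poly[OF assms poly_deriv_at_mult[OF p' p']] by simp
qed

text \<open>The final summand is a normalisation effect: P_n occurs twice, each time giving - X_t
  X_a, and the factor 1 / h_n gives back one + X_t X_a.\<close>

lemma DERIV_X:
  assumes "0 < t" "t < 1" "a \<in> {0, 1}"
  shows "(X n p a has_real_derivative
    (\<gamma> * X n p a t - p * X n \<gamma> t t - 2 * V n \<gamma> t t * X n p a t + 2 * X n \<gamma> t t * V n p a t) / (a - t)
     - X n \<gamma> t t * X n p a t) (at t)"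
proof -
  obtain p' where p': "poly_deriv_at n (\<lambda>s. gs s n) p' t"
    and Up: "\<And>g. U t a (p' * g) =
       (X n \<gamma> t t * (U t a (gs t (Suc n) * g) - U t t (gs t (Suc n) * g))
        - (V n \<gamma> t t - \<gamma>) * (U t a (gs t n * g) - U t t (gs t n * g))) / (a - t) - X n \<gamma> t t * U t a (gs t n * g)"
    using gs_deform[OF assms(1,2), of n] assms(3) by metis
  let ?P = "gs t n" let ?Q = "gs t (Suc n)" let ?h = "L t (?P * ?P)"
  let ?x = "U t a (?P * ?P)"
  have h: "?h > 0" using h_pos assms by blast
  have a: "a \<in> {0, 1, t}" using assms by auto
  have D: "((\<lambda>s. U s a (gs s n * gs s n)) has_real_derivative
      2 * U t a (p' * ?P) - \<gamma> * (?x - U t t (?P * ?P)) / (a - t)) (at t)"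
    using DERIV_U_poly[OF assms poly_deriv_at_mult[OF p' p']]
    unfolding U_add[OF assms(1,2) a] mult.commute[of ?P p'] by simp
  have D': "(X n p a has_real_derivative
     (p * (2 * U t a (p' * ?P) - \<gamma> * (?x - U t t (?P * ?P)) / (a - t)) * ?h
       - p * ?x * (- X n \<gamma> t t * ?h)) / (?h * ?h)) (at t)"
    unfolding X_def[of n p a, abs_def]
    by (rule DERIV_divide[OF DERIV_cmult[OF D] DERIV_h[OF assms(1,2)]]) (use h in simp)
  have "(p * (2 * U t a (p' * ?P) - \<gamma> * (?x - U t t (?P * ?P)) / (a - t)) * ?h - p * ?x * (- X n \<gamma> t t * ?h)) / (?h * ?h)
    = p / ?h * (2 * U t a (p' * ?P) - \<gamma> * (?x - U t t (?P * ?P)) / (a - t)) + X n \<gamma> t t * X n p a t"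
    using h by (simp add: X_def[of n p a] add_divide_distrib)
  also have "\<dots> = (\<gamma> * X n p a t - p * X n \<gamma> t t - 2 * V n \<gamma> t t * X n p a t + 2 * X n \<gamma> t t * V n p a t) / (a - t)
     - X n \<gamma> t t * X n p a t"
  proof -
    define e where "e = a - t"
    have e0: "e \<noteq> 0" using assms by (auto simp: e_def)
    have t: "U t t (?P * ?P) = X n \<gamma> t t * ?h / \<gamma>" "U t t (?P * ?Q) = V n \<gamma> t t * ?h / \<gamma>"
      using h exps_pos by (simp_all add: X_def V_def)
    have xa: "X n p a t = p * ?x / ?h" "V n p a t = p * U t a (?P * ?Q) / ?h"
      by (simp_all add: X_def V_def)
    show ?thesis
      unfolding Up mult.commute[of ?Q ?P] xa t e_def[symmetric] using h e0 exps_pos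
      by (simp add: field_simps)
  qed
  finally show ?thesis using D' by simp
qed

text \<open>P_n occurs once here, so its - X_t V_a cancels against the derivative of 1 / h_n, and a
  pure commutator entry remains.\<close>

lemma DERIV_V:
  assumes "0 < t" "t < 1" "a \<in> {0, 1}"
  shows "(V n p a has_real_derivative
    (X n \<gamma> t t * Z n p a t - Z n \<gamma> t t * X n p a t) / (a - t)) (at t)"
proof -
  obtain p' q' where p': "poly_deriv_at n (\<lambda>s. gs s n) p' t" and q': "poly_deriv_at (Suc n) (\<lambda>s. gs s (Suc n)) q' t"
    and Up: "\<And>g. U t a (p' * g) =
       (X n \<gamma> t t * (U t a (gs t (Suc n) * g) - U t t (gs t (Suc n) * g))
        - (V n \<gamma> t t - \<gamma>) * (U t a (gs t n * g) - U t t (gs t n * g))) / (a - t) - X n \<gamma> t t * U t a (gs t n * g)"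
    and Uq: "\<And>g. U t a (q' * g) =
       (V n \<gamma> t t * (U t a (gs t (Suc n) * g) - U t t (gs t (Suc n) * g))
        - Z n \<gamma> t t * (U t a (gs t n * g) - U t t (gs t n * g))) / (a - t)"
    using gs_deform[OF assms(1,2), of n] assms(3) by metis
  let ?P = "gs t n" let ?Q = "gs t (Suc n)" let ?h = "L t (?P * ?P)"
  let ?u = "U t a (?P * ?Q)"
  have h: "?h > 0" using h_pos assms by blast
  have a: "a \<in> {0, 1, t}" using assms by auto
  have D: "((\<lambda>s. U s a (gs s n * gs s (Suc n))) has_real_derivative
      U t a (p' * ?Q) + U t a (q' * ?P) - \<gamma> * (?u - U t t (?P * ?Q)) / (a - t)) (at t)"
    using DERIV_U_poly[OF assms poly_deriv_at_mult[OF p' q']]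
    unfolding U_add[OF assms(1,2) a] mult.commute[of ?P q'] by simp
  have D': "(V n p a has_real_derivative
     (p * (U t a (p' * ?Q) + U t a (q' * ?P) - \<gamma> * (?u - U t t (?P * ?Q)) / (a - t)) * ?h
       - p * ?u * (- X n \<gamma> t t * ?h)) / (?h * ?h)) (at t)"
    unfolding V_def[of n p a, abs_def]
    by (rule DERIV_divide[OF DERIV_cmult[OF D] DERIV_h[OF assms(1,2)]]) (use h in simp)
  have "(p * (U t a (p' * ?Q) + U t a (q' * ?P) - \<gamma> * (?u - U t t (?P * ?Q)) / (a - t)) * ?h - p * ?u * (- X n \<gamma> t t * ?h)) / (?h * ?h)
    = p / ?h * (U t a (p' * ?Q) + U t a (q' * ?P) - \<gamma> * (?u - U t t (?P * ?Q)) / (a - t) + X n \<gamma> t t * ?u)"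
    using h by (simp add: distrib_left add_divide_distrib)
  also have "\<dots> = (X n \<gamma> t t * Z n p a t - Z n \<gamma> t t * X n p a t) / (a - t)"
  proof -
    define e where "e = a - t"
    have e0: "e \<noteq> 0" using assms by (auto simp: e_def)
    have t: "U t t (?P * ?P) = X n \<gamma> t t * ?h / \<gamma>" "U t t (?P * ?Q) = V n \<gamma> t t * ?h / \<gamma>"
       "U t t (?Q * ?Q) = Z n \<gamma> t t * ?h / \<gamma>"
      using h exps_pos by (simp_all add: X_def V_def Z_def)
    have xa: "X n p a t = p * U t a (?P * ?P) / ?h" "Z n p a t = p * U t a (?Q * ?Q) / ?h"
      by (simp_all add: X_def Z_def)
    show ?thesis
      unfolding Up Uq mult.commute[of ?Q ?P] xa t e_def[symmetric] using h e0 exps_pos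
      by (simp add: field_simps)
  qed
  finally show ?thesis using D' by simp
qed

section \<open>From the Schlesinger equations to Painleve VI\<close>

text \<open>R_n is - X at 1, the sign coming from 1 - y in place of y - 1; the two sum relations for
  X then convert it to X at 0.\<close>

lemma Sn_eq:
  assumes "0 < t" "t < 1"
  shows "Sn \<alpha> \<beta> \<gamma> A B n t = t * X n \<alpha> 0 t / (2 * real n + \<alpha> + \<beta> + \<gamma> + 1)"
proof -
  let ?\<kappa> = "2 * real n + \<alpha> + \<beta> + \<gamma> + 1"
  have \<kappa>: "?\<kappa> > 0" using exps_pos by (simp add: add_pos_pos add_nonneg_pos)
  have h: "hn \<alpha> \<beta> \<gamma> A B n t = L t (gs t n * gs t n)"
    by (simp add: hn_def monic_OP_eq[OF assms] L_def power2_eq_square)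
  have "(poly (gs t n) y)\<^sup>2 * w y t / (1 - y) = - (poly (gs t n * gs t n) y * w y t / (y - 1))" for y
    unfolding minus_divide_right by (simp add: power2_eq_square)
  then have "Rn \<alpha> \<beta> \<gamma> A B n t = - X n \<beta> 1 t"
    by (simp add: Rn_def h monic_OP_eq[OF assms] X_def U_def del: poly_mult)
  then have S: "Sn \<alpha> \<beta> \<gamma> A B n t = ((1 - t) * X n \<beta> 1 t + ?\<kappa>) / ?\<kappa>"
    using \<kappa> by (simp add: Sn_def field_simps)
  have "(1 - t) * X n \<beta> 1 t + ?\<kappa> = t * X n \<alpha> 0 t"
    using X_sum[OF assms, of n] X_sum_weighted[OF assms, of n] by algebra
  with S show ?thesis by simp
qed

lemma Sn_painleve:
  fixes n :: nat
  defines "S \<equiv> Sn \<alpha> \<beta> \<gamma> A B n"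
      and "\<mu>1 \<equiv> (2 * real n + \<alpha> + \<beta> + \<gamma> + 1)\<^sup>2 / 2"
      and "\<mu>2 \<equiv> - (\<alpha>\<^sup>2 / 2)"
      and "\<mu>3 \<equiv> \<beta>\<^sup>2 / 2"
      and "\<mu>4 \<equiv> (1 - \<gamma>\<^sup>2) / 2"
  shows "\<exists>S' S''. \<forall>t\<in>{0<..<1::real}.
           (S has_real_derivative S' t) (at t) \<and>
           (S' has_real_derivative S'' t) (at t) \<and>
           (S t \<noteq> 0 \<and> S t \<noteq> 1 \<and> S t \<noteq> t \<longrightarrow>
             S'' t =
               1/2 * (1 / S t + 1 / (S t - 1) + 1 / (S t - t)) * (S' t)\<^sup>2
               - (1 / t + 1 / (t - 1) + 1 / (S t - t)) * S' t
               + S t * (S t - 1) * (S t - t) / (t\<^sup>2 * (t - 1)\<^sup>2) *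
                 (\<mu>1 + \<mu>2 * t / (S t)\<^sup>2 + \<mu>3 * (t - 1) / (S t - 1)\<^sup>2
                  + \<mu>4 * t * (t - 1) / (S t - t)\<^sup>2))"
proof -
  define \<kappa> where "\<kappa> = 2 * real n + \<alpha> + \<beta> + \<gamma> + 1"
  have \<kappa>: "\<kappa> > 0" unfolding \<kappa>_def using exps_pos by (simp add: add_pos_pos add_nonneg_pos)
  \<comment> \<open>Up to sign, M, M - K - \<kappa> and K - 1 are the centred values 2 V - p at 0, 1
    and t. With this choice each V (V - p) is a quarter of a difference of squares.\<close>
  define M where "M t = \<alpha> - 2 * V n \<alpha> 0 t" for t
  define K where "K t = \<beta> - \<kappa> + M t - 2 * V n \<beta> 1 t" for t
  define G where "G t = (t - 1) * S t * K t + (S t - t) * M t - \<kappa> * S t * (S t - t)" for t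
  define S' where "S' t = G t / (t * (t - 1))" for t
  define V0' where "V0' t = (X n \<gamma> t t * Z n \<alpha> 0 t - Z n \<gamma> t t * X n \<alpha> 0 t) / (0 - t)" for t
  define V1' where "V1' t = (X n \<gamma> t t * Z n \<beta> 1 t - Z n \<gamma> t t * X n \<beta> 1 t) / (1 - t)" for t
  \<comment> \<open>The quotient rule for G / (t (t - 1)), with that quotient itself written back as
    S' in the last summand.\<close>
  define S'' where "S'' t = (S t * K t + (t - 1) * S' t * K t - 2 * (t - 1) * S t * (V0' t + V1' t) + (S' t - 1) * M t
     - 2 * (S t - t) * V0' t - \<kappa> * S' t * (S t - t) - \<kappa> * S t * (S' t - 1) - (2 * t - 1) * S' t) / (t * (t - 1))" for t
  have S_eq: "S t = t * X n \<alpha> 0 t / \<kappa>" if "0 < t" "t < 1" for t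
    using Sn_eq[OF that, of n] by (simp add: S_def \<kappa>_def)
  have main: "(S has_real_derivative S' t) (at t)" "(S' has_real_derivative S'' t) (at t)"
    "S t \<noteq> 0 \<and> S t \<noteq> 1 \<and> S t \<noteq> t \<Longrightarrow> S'' t =
               1/2 * (1 / S t + 1 / (S t - 1) + 1 / (S t - t)) * (S' t)\<^sup>2
               - (1 / t + 1 / (t - 1) + 1 / (S t - t)) * S' t
               + S t * (S t - 1) * (S t - t) / (t\<^sup>2 * (t - 1)\<^sup>2) *
                 (\<mu>1 + \<mu>2 * t / (S t)\<^sup>2 + \<mu>3 * (t - 1) / (S t - 1)\<^sup>2
                  + \<mu>4 * t * (t - 1) / (S t - t)\<^sup>2)"
    if t01: "0 < t" "t < 1" for t
  proof -
    have nz: "t \<noteq> 0" "t - 1 \<noteq> 0" "1 - t \<noteq> 0" "t \<noteq> 1" using t01 by auto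
    have X0: "X n \<alpha> 0 t = \<kappa> * S t / t" using S_eq[OF t01] \<kappa> nz by simp
    \<comment> \<open>The two sum relations determine all three X from S: they are multiples of S, S
      - 1 and S - t.\<close>
    have s1: "X n \<alpha> 0 t + X n \<beta> 1 t + X n \<gamma> t t = 0" by (rule X_sum[OF t01])
    have s2: "X n \<beta> 1 t + t * X n \<gamma> t t = - \<kappa>"
      using X_sum_weighted[OF t01, of n] by (simp add: \<kappa>_def)
    have "X n \<gamma> t t * (t - 1) = X n \<alpha> 0 t - \<kappa>" using s1 s2 by algebra
    then have "X n \<gamma> t t * (t * (t - 1)) = \<kappa> * (S t - t)"
      unfolding X0 using nz by (simp add: field_simps)
    then have Xt: "X n \<gamma> t t = \<kappa> * (S t - t) / (t * (t - 1))" using nz by (simp add: eq_divide_eq)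
    have "X n \<beta> 1 t * (t - 1) = - \<kappa> * (S t - 1)"
    proof -
      have "X n \<beta> 1 t * (t - 1) = - t * X n \<alpha> 0 t + \<kappa>" using s1 s2 by algebra
      then show ?thesis unfolding X0 using nz by (simp add: algebra_simps)
    qed
    then have X1: "X n \<beta> 1 t = - \<kappa> * (S t - 1) / (t - 1)" by (rule eq_divide_imp[OF nz(2)])
    have V0: "V n \<alpha> 0 t = (\<alpha> - M t) / 2" by (simp add: M_def)
    have V1: "V n \<beta> 1 t = (\<beta> - \<kappa> + M t - K t) / 2" by (simp add: K_def)
    have Vt: "V n \<gamma> t t = (K t - 1 + \<gamma>) / 2"
      using V_sum[OF t01, of n] unfolding V0 V1 by (simp add: \<kappa>_def field_simps)
    have "((\<lambda>s. s * X n \<alpha> 0 s / \<kappa>) has_real_derivative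
      (X n \<alpha> 0 t + t * ((\<gamma> * X n \<alpha> 0 t - \<alpha> * X n \<gamma> t t - 2 * V n \<gamma> t t * X n \<alpha> 0 t + 2 * X n \<gamma> t t * V n \<alpha> 0 t) / (0 - t)
     - X n \<gamma> t t * X n \<alpha> 0 t)) / \<kappa>) (at t)"
      by (rule DERIV_cong[OF DERIV_cdivide[OF DERIV_mult[OF DERIV_ident DERIV_X[OF t01]]]]) simp_all
    also have "(X n \<alpha> 0 t + t * ((\<gamma> * X n \<alpha> 0 t - \<alpha> * X n \<gamma> t t - 2 * V n \<gamma> t t * X n \<alpha> 0 t + 2 * X n \<gamma> t t * V n \<alpha> 0 t) / (0 - t)
     - X n \<gamma> t t * X n \<alpha> 0 t)) / \<kappa> = S' t"
    proof -
      have "(X n \<alpha> 0 t + t * ((\<gamma> * X n \<alpha> 0 t - \<alpha> * X n \<gamma> t t - 2 * V n \<gamma> t t * X n \<alpha> 0 t + 2 * X n \<gamma> t t * V n \<alpha> 0 t) / (0 - t)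
     - X n \<gamma> t t * X n \<alpha> 0 t)) = X n \<alpha> 0 t * K t + X n \<gamma> t t * M t - t * X n \<gamma> t t * X n \<alpha> 0 t"
        unfolding V0 Vt using nz by (simp add: field_simps)
      also have "\<dots> = \<kappa> * S' t"
        unfolding X0 Xt S'_def G_def using nz by (simp add: divide_simps) (simp add: algebra_simps)
      finally show ?thesis using \<kappa> by simp
    qed
    finally have DS: "((\<lambda>s. s * X n \<alpha> 0 s / \<kappa>) has_real_derivative S' t) (at t)" .
    have "eventually (\<lambda>s. s \<in> {0<..<1}) (nhds t)" using t01 by (intro eventually_nhds_in_open) auto
    then have ev: "eventually (\<lambda>s. s * X n \<alpha> 0 s / \<kappa> = S s) (nhds t)"
      by eventually_elim (use S_eq in auto)
    show DS: "(S has_real_derivative S' t) (at t)"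
      using DS by (rule DERIV_cong_ev[OF refl ev refl, THEN iffD1])
    have DV0: "(V n \<alpha> 0 has_real_derivative V0' t) (at t)"
      unfolding V0'_def by (rule DERIV_V[OF t01]) simp
    have DV1: "(V n \<beta> 1 has_real_derivative V1' t) (at t)"
      unfolding V1'_def by (rule DERIV_V[OF t01]) simp
    have DM: "(M has_real_derivative - 2 * V0' t) (at t)"
      unfolding M_def[abs_def] by (auto intro!: derivative_eq_intros DV0)
    have DK: "(K has_real_derivative - 2 * (V0' t + V1' t)) (at t)"
      unfolding K_def[abs_def] by (auto intro!: derivative_eq_intros DM DV1)
    have DG: "(G has_real_derivative S t * K t + (t - 1) * S' t * K t - 2 * (t - 1) * S t * (V0' t + V1' t) + (S' t - 1) * M t
     - 2 * (S t - t) * V0' t - \<kappa> * S' t * (S t - t) - \<kappa> * S t * (S' t - 1)) (at t)"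
      unfolding G_def[abs_def] by (rule derivative_eq_intros refl DS DM DK)+ (simp add: algebra_simps)
    show "(S' has_real_derivative S'' t) (at t)"
    proof -
      have DT: "((\<lambda>t. t * (t - 1)) has_real_derivative 2 * t - 1) (at t)"
        by (auto intro!: derivative_eq_intros)
      have "((\<lambda>t. G t / (t * (t - 1))) has_real_derivative
        ((S t * K t + (t - 1) * S' t * K t - 2 * (t - 1) * S t * (V0' t + V1' t) + (S' t - 1) * M t
     - 2 * (S t - t) * V0' t - \<kappa> * S' t * (S t - t) - \<kappa> * S t * (S' t - 1)) * (t * (t - 1)) - G t * (2 * t - 1)) /
         (t * (t - 1) * (t * (t - 1)))) (at t)"
        by (rule DERIV_divide[OF DG DT]) (use nz in simp)
      moreover have "(g * T - G t * d) / (T * T) = (g - d * (G t / T)) / T" if "T \<noteq> 0" for g d T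
        using that by (simp add: field_simps)
      ultimately show ?thesis
        unfolding S'_def[abs_def] S''_def using nz by simp
    qed
    show "S'' t =
               1/2 * (1 / S t + 1 / (S t - 1) + 1 / (S t - t)) * (S' t)\<^sup>2
               - (1 / t + 1 / (t - 1) + 1 / (S t - t)) * S' t
               + S t * (S t - 1) * (S t - t) / (t\<^sup>2 * (t - 1)\<^sup>2) *
                 (\<mu>1 + \<mu>2 * t / (S t)\<^sup>2 + \<mu>3 * (t - 1) / (S t - 1)\<^sup>2
                  + \<mu>4 * t * (t - 1) / (S t - t)\<^sup>2)" if S: "S t \<noteq> 0 \<and> S t \<noteq> 1 \<and> S t \<noteq> t"
    proof -
      have S_nz: "S t \<noteq> 0" "S t - 1 \<noteq> 0" "S t - t \<noteq> 0" using S by auto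
      define A0 where "A0 = ((M t)\<^sup>2 - \<alpha>\<^sup>2) / 4"
      define A1 where "A1 = ((M t - K t - \<kappa>)\<^sup>2 - \<beta>\<^sup>2) / 4"
      define At where "At = ((K t - 1)\<^sup>2 - \<gamma>\<^sup>2) / 4"
      have XZ: "X n p a t * Z n p a t = V n p a t * (V n p a t - p)" if "a \<in> {0, 1, t}" for p a
        by (rule XZ_eq[OF t01 that])
      \<comment> \<open>The determinant relations give each Z after division by the corresponding X,
        hence by S, S - 1 or S - t; here the three excluded values of S matter.\<close>
      have "X n \<alpha> 0 t * Z n \<alpha> 0 t = A0"
        using XZ[of 0 \<alpha>] unfolding V0 A0_def by (simp add: power2_eq_square field_simps)
      then have Z0: "Z n \<alpha> 0 t = A0 * t / (\<kappa> * S t)"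
        unfolding X0 using S_nz nz \<kappa> by (simp add: field_simps)
      have "X n \<beta> 1 t * Z n \<beta> 1 t = A1"
        using XZ[of 1 \<beta>] unfolding V1 A1_def by (simp add: power2_eq_square field_simps)
      then have Z1: "Z n \<beta> 1 t = - A1 * (t - 1) / (\<kappa> * (S t - 1))"
        unfolding X1 using S_nz nz \<kappa> by (simp add: divide_simps) (simp add: algebra_simps)
      have "X n \<gamma> t t * Z n \<gamma> t t = At"
        using XZ[of t \<gamma>] unfolding Vt At_def by (simp add: power2_eq_square field_simps)
      then have Zt: "Z n \<gamma> t t = At * (t * (t - 1)) / (\<kappa> * (S t - t))"
        unfolding Xt using S_nz nz \<kappa> by (simp add: divide_simps) (simp add: algebra_simps)
      have v0: "V0' t = ((t - 1) * S t * At / (S t - t) - (S t - t) * A0 / ((t - 1) * S t)) / t"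
      proof -
        have "X n \<gamma> t t * Z n \<alpha> 0 t = (S t - t) * A0 / ((t - 1) * S t)"
          unfolding Xt Z0 using nz \<kappa> by simp
        moreover have "Z n \<gamma> t t * X n \<alpha> 0 t = (t - 1) * S t * At / (S t - t)"
          unfolding Zt X0 using nz \<kappa> by simp
        ultimately show ?thesis unfolding V0'_def by (simp add: minus_divide_left)
      qed
      have v1: "V1' t = ((S t - t) * A1 / (t * (S t - 1)) - t * (S t - 1) * At / (S t - t)) / (t - 1)"
      proof -
        have "X n \<gamma> t t * Z n \<beta> 1 t = - ((S t - t) * A1 / (t * (S t - 1)))"
          unfolding Xt Z1 using nz \<kappa> by simp
        moreover have "Z n \<gamma> t t * X n \<beta> 1 t = - (t * (S t - 1) * At / (S t - t))"
          unfolding Zt X1 using nz \<kappa> by simp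
        moreover have "1 - t = - (t - 1)" by simp
        ultimately show ?thesis unfolding V1'_def by (simp only: divide_minus_right minus_divide_left) simp
      qed
      have "S t \<noteq> 0" "S t \<noteq> 1" "S t \<noteq> t" using S by auto
      from painleve_VI_algebra[where \<alpha> = \<alpha> and \<beta> = \<beta> and \<gamma> = \<gamma> and K = "K t" and M = "M t" and \<kappa> = \<kappa>,
          OF this nz(1,4),
          folded A0_def A1_def At_def, folded v0 v1, folded G_def, folded S'_def, folded S''_def]
      show ?thesis unfolding \<mu>1_def \<mu>2_def \<mu>3_def \<mu>4_def \<kappa>_def .
    qed
  qed
  show ?thesis
    by (rule exI[of _ S'], rule exI[of _ S'']) (use main in auto)
qed

end

theorem theorem3p5:
  fixes \<alpha> \<beta> \<gamma> A B :: real and n :: nat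
  assumes "\<alpha> > 0" "\<beta> > 0" "\<gamma> > 0" "A \<ge> 0" "A + B \<ge> 0" "\<not> (A = 0 \<and> A + B = 0)"
  defines "S \<equiv> Sn \<alpha> \<beta> \<gamma> A B n"
      and "\<mu>1 \<equiv> (2 * real n + \<alpha> + \<beta> + \<gamma> + 1)\<^sup>2 / 2"
      and "\<mu>2 \<equiv> - (\<alpha>\<^sup>2 / 2)"
      and "\<mu>3 \<equiv> \<beta>\<^sup>2 / 2"
      and "\<mu>4 \<equiv> (1 - \<gamma>\<^sup>2) / 2"
  shows "\<exists>S' S''. \<forall>t\<in>{0<..<1::real}.
           (S has_real_derivative S' t) (at t) \<and>
           (S' has_real_derivative S'' t) (at t) \<and>
           (S t \<noteq> 0 \<and> S t \<noteq> 1 \<and> S t \<noteq> t \<longrightarrow>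
             S'' t =
               1/2 * (1 / S t + 1 / (S t - 1) + 1 / (S t - t)) * (S' t)\<^sup>2
               - (1 / t + 1 / (t - 1) + 1 / (S t - t)) * S' t
               + S t * (S t - 1) * (S t - t) / (t\<^sup>2 * (t - 1)\<^sup>2) *
                 (\<mu>1 + \<mu>2 * t / (S t)\<^sup>2 + \<mu>3 * (t - 1) / (S t - 1)\<^sup>2
                  + \<mu>4 * t * (t - 1) / (S t - t)\<^sup>2))"
proof -
  interpret pvi \<alpha> \<beta> \<gamma> A B by unfold_locales (use assms(1-6) in auto)
  show ?thesis
    unfolding S_def \<mu>1_def \<mu>2_def \<mu>3_def \<mu>4_def by (rule Sn_painleve)
qed

end
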